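(* Let $(K,v)$ be a valued field and fix an extension $\overline v$ of $v$ to an algebraic closure $\overline K$ of $K$. Let $(K(X)|K,w)$ be a value transcendental extension of $(K,v)$ and $E=\{z_\nu\}_{\nu<\lambda}$ a pseudo divergent sequence in $(K,v)$. Assume that $X$ is not a limit of $E$ (with respect to $w$). Then the following are equivalent: (i) $w=v_E$. (ii) There exists some common extension $\overline w$ of $w$ and $\overline v$ to $\overline K(X)$ such that, for $a\in\overline K$, $(a,\overline w(X-a))$ is a pair of definition for $w$ over $K$ if and only if $a$ is a limit of $E$. (iii) $(z_\mu,w(X-z_\mu))$ is a pair of definition for $w$ over $K$ for some $z_\mu\in E$; further, for all $\beta\in\overline v\overline K$ we have $\beta<w(X-z_\mu)$ if and only if $\beta<\delta_\nu$ for all $\nu<\lambda$.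
   Context: Conventions. A valued field $(K,v)$ is a field with a (Krull) valuation, value group $vK$ (written additively). Valuations with the same valuation ring are identified, and if $w$ extends $v$ then $vK$ is regarded as a subgroup of the value group of $w$. For a common extension $\overline w$ of $w$ and $\overline v$ to $\overline K(X)$, all values are compared in $\overline w\,\overline K(X)$. $(K(X)|K,w)$ is value transcendental if $\dim_{\mathbb Q}\bigl(\mathbb Q\otimes_{\mathbb Z}(wK(X)/vK)\bigr)=1$. Let $\lambda$ be a limit ordinal. $E=\{z_\nu\}_{\nu<\lambda}\subseteq K$ is pseudo divergent (pds) if $v(z_{\nu_1}-z_{\nu_2})>v(z_{\nu_2}-z_{\nu_3})$ for all $\nu_1<\nu_2<\nu_3<\lambda$; put $\delta_\nu:=v(z_\nu-z_\mu)$ for any $\mu<\nu$ (independent of $\mu$; defined for $\nu\ge 1$). An element $y$ of a valued extension field is a limit of $E$ if the value of $y-z_\nu$ is $\delta_\nu$ for all sufficiently large $\nu$; for $y\in\overline K$ this is with respect to $\overline v$. $v_E$ is the valuation of $K(X)$ with valuation ring $\{\phi\in K(X)\mid v\phi(z_\nu)\ge 0$ for all sufficiently large $\nu\}$ (maximal ideal given by $v\phi(z_\nu)>0$ for all sufficiently large $\nu$); it extends $v$. Pairs of definition. For $a\in\overline K$ and $\alpha$ in an ordered abelian group containing $\overline v\overline K$, $\overline v_{a,\alpha}$ is the valuation of $\overline K(X)$ with $\overline v_{a,\alpha}(\sum_i c_i(X-a)^i)=\min_i\{\overline v c_i+i\alpha\}$ ($c_i\in\overline K$). Given a common extension $\overline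 w$ of $w$ and $\overline v$ to $\overline K(X)$, a pair $(a,\alpha)\in\overline K\times\overline w\,\overline K(X)$ is a pair of definition for $w$ over $K$ (with respect to $\overline w$) if $\overline w=\overline v_{a,\alpha}$; equivalently, $\alpha=\overline w(X-a)=\max\{\overline w(X-c)\mid c\in\overline K\}$. In (iii) this is with respect to some common extension $\overline w$ of $w$ and $\overline v$ to $\overline K(X)$. *)

theory Defs
  imports
    "HOL-Algebra.Algebraic_Closure_Type"
    "HOL-Library.Extended"
    "HOL-Library.Poly_Mapping"
begin

section \<open>Krull valuations\<close>

text \<open>
  A valuation takes values in \<open>'g extended\<close>, where \<open>'g\<close> is an arbitrary ordered abelian group;
  \<open>Pinf\<close> is the value of \<open>0\<close> and \<open>Minf\<close> is never attained. The map need not be onto \<open>'g\<close>: the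
  value group is the subgroup \<open>value_group v\<close> of \<open>'g\<close>. Valuations of different fields are
  compared by letting them take values in the same \<open>'g\<close>. For valuations \<open>w\<close> of \<open>K(X)\<close> and
  \<open>vbar\<close> of the algebraic closure of \<open>K\<close> extending the same \<open>v\<close>, the divisible hull of the value
  group of \<open>w\<close> is such a \<open>'g\<close>: the value group of \<open>vbar\<close>, and that of every common extension of
  \<open>w\<close> and \<open>vbar\<close>, is torsion over that of \<open>v\<close>, respectively \<open>w\<close>, and so embeds uniquely.
\<close>

definition valuation :: "('f::field \<Rightarrow> 'g::linordered_ab_group_add extended) \<Rightarrow> bool" where
  "valuation v \<longleftrightarrow>
     (\<forall>x. v x = Pinf \<longleftrightarrow> x = 0) \<and> (\<forall>x. v x \<noteq> Minf) \<and>
     (\<forall>x y. v (x * y) = v x + v y) \<and>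
     (\<forall>x y. v (x + y) \<ge> min (v x) (v y))"

definition value_group :: "('f::field \<Rightarrow> 'g::linordered_ab_group_add extended) \<Rightarrow> 'g set" where
  "value_group v = {\<gamma>. \<exists>x. x \<noteq> 0 \<and> v x = Fin \<gamma>}"

definition valuation_ring :: "('f::field \<Rightarrow> 'g::linordered_ab_group_add extended) \<Rightarrow> 'f set" where
  "valuation_ring v = {x. v x \<ge> 0}"

definition extends_along ::
  "('e \<Rightarrow> 'f) \<Rightarrow> ('e::field \<Rightarrow> 'g::linordered_ab_group_add extended) \<Rightarrow>
   ('f::field \<Rightarrow> 'g extended) \<Rightarrow> bool" where
  "extends_along \<iota> v u \<longleftrightarrow> (\<forall>x. u (\<iota> x) = v x)"


section \<open>Rational functions\<close>

text \<open>\<open>K(X)\<close> is \<open>'a poly fract\<close> and its analogue over the algebraic closure is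
  \<open>'a alg_closure poly fract\<close>.\<close>

definition ratfun_const :: "'f::field \<Rightarrow> 'f poly fract" where
  "ratfun_const c = Fract [:c:] 1"

definition ratfun_X :: "'f::field poly fract" where
  "ratfun_X = Fract [:0, 1:] 1"

lemma map_poly_to_ac_mult:
  "map_poly to_ac (p * q) = map_poly to_ac p * map_poly to_ac q"
  by (rule poly_eqI) (simp add: coeff_map_poly coeff_mult to_ac_sum)

definition ratfun_to_ac :: "'a::field poly fract \<Rightarrow> 'a alg_closure poly fract" where
  "ratfun_to_ac \<phi> = (THE \<psi>. \<exists>p q. q \<noteq> 0 \<and> \<phi> = Fract p q \<and>
     \<psi> = Fract (map_poly to_ac p) (map_poly to_ac q))"

lemma ratfun_to_ac_Fract:
  assumes "q \<noteq> 0"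
  shows "ratfun_to_ac (Fract p q) = Fract (map_poly to_ac p) (map_poly to_ac q)"
  unfolding ratfun_to_ac_def
proof (rule the_equality)
  show "\<exists>p' q'. q' \<noteq> 0 \<and> Fract p q = Fract p' q' \<and>
      Fract (map_poly to_ac p) (map_poly to_ac q) = Fract (map_poly to_ac p') (map_poly to_ac q')"
    using assms by blast
next
  fix \<psi> assume "\<exists>p' q'. q' \<noteq> 0 \<and> Fract p q = Fract p' q' \<and>
      \<psi> = Fract (map_poly to_ac p') (map_poly to_ac q')"
  then obtain p' q' where *: "q' \<noteq> 0" "Fract p q = Fract p' q'"
      "\<psi> = Fract (map_poly to_ac p') (map_poly to_ac q')"
    by blast
  with assms have "p' * q = p * q'" by (simp add: eq_fract)
  hence "map_poly to_ac p' * map_poly to_ac q = map_poly to_ac p * map_poly to_ac q'"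
    by (simp flip: map_poly_to_ac_mult)
  with assms * show "\<psi> = Fract (map_poly to_ac p) (map_poly to_ac q)"
    by (simp add: eq_fract map_poly_eq_0_iff)
qed

text \<open>The value of a rational function at a point; unspecified if the point is a pole.\<close>

definition ratfun_eval :: "'f::field poly fract \<Rightarrow> 'f \<Rightarrow> 'f" where
  "ratfun_eval \<phi> x = (THE y. \<exists>p q. \<phi> = Fract p q \<and> poly q x \<noteq> 0 \<and> y = poly p x / poly q x)"

lemma ratfun_eval_Fract:
  assumes "poly q x \<noteq> 0"
  shows "ratfun_eval (Fract p q) x = poly p x / poly q x"
  unfolding ratfun_eval_def
proof (rule the_equality)
  show "\<exists>p' q'. Fract p q = Fract p' q' \<and> poly q' x \<noteq> 0 \<and> poly p x / poly q x = poly p' x / poly q' x"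
    using assms by blast
next
  fix y assume "\<exists>p' q'. Fract p q = Fract p' q' \<and> poly q' x \<noteq> 0 \<and> y = poly p' x / poly q' x"
  then obtain p' q' where *: "Fract p q = Fract p' q'" "poly q' x \<noteq> 0" "y = poly p' x / poly q' x"
    by blast
  with assms have "q \<noteq> 0" "q' \<noteq> 0" by auto
  with * have "p * q' = p' * q" by (simp add: eq_fract)
  hence "poly p x * poly q' x = poly p' x * poly q x" by (simp flip: poly_mult)
  with assms * show "y = poly p x / poly q x" by (simp add: frac_eq_eq)
qed


section \<open>Value transcendental extensions\<close>

text \<open>
  For subgroups \<open>H \<subseteq> G\<close> of \<open>'g\<close>, the tensor product of the rationals with \<open>G/H\<close> over the integers
  is presented as the formal integral combinations of pairs \<open>(q, g)\<close> with \<open>g \<in> G\<close> (the pair stands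
  for \<open>q \<otimes> (g + H)\<close>) modulo the subgroup \<open>rat_tensor_null G H\<close>.
\<close>

definition rat_tensor_carrier :: "'g::ab_group_add set \<Rightarrow> (rat \<times> 'g \<Rightarrow>\<^sub>0 int) set" where
  "rat_tensor_carrier G = {t. snd ` Poly_Mapping.keys t \<subseteq> G}"

abbreviation pure_tensor :: "rat \<Rightarrow> 'g \<Rightarrow> (rat \<times> 'g \<Rightarrow>\<^sub>0 int)" where
  "pure_tensor q g \<equiv> Poly_Mapping.single (q, g) 1"

inductive_set rat_tensor_null ::
  "'g::ab_group_add set \<Rightarrow> 'g set \<Rightarrow> (rat \<times> 'g \<Rightarrow>\<^sub>0 int) set" for G H where
  zero: "0 \<in> rat_tensor_null G H"
| diff: "s \<in> rat_tensor_null G H \<Longrightarrow> t \<in> rat_tensor_null G H \<Longrightarrow> s - t \<in> rat_tensor_null G H"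
| add_left: "g \<in> G \<Longrightarrow>
    pure_tensor (q + r) g - pure_tensor q g - pure_tensor r g \<in> rat_tensor_null G H"
| add_right: "g \<in> G \<Longrightarrow> h \<in> G \<Longrightarrow>
    pure_tensor q (g + h) - pure_tensor q g - pure_tensor q h \<in> rat_tensor_null G H"
| quotient: "h \<in> H \<Longrightarrow> pure_tensor q h \<in> rat_tensor_null G H"

definition rat_tensor_scale :: "rat \<Rightarrow> (rat \<times> 'g \<Rightarrow>\<^sub>0 int) \<Rightarrow> (rat \<times> 'g \<Rightarrow>\<^sub>0 int)" where
  "rat_tensor_scale q t =
     (\<Sum>k\<in>Poly_Mapping.keys t. Poly_Mapping.single (q * fst k, snd k) (Poly_Mapping.lookup t k))"

text \<open>The rational vector space just described has dimension one: a single nonzero vector spans it.\<close>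

definition rat_tensor_dim_one :: "'g::ab_group_add set \<Rightarrow> 'g set \<Rightarrow> bool" where
  "rat_tensor_dim_one G H \<longleftrightarrow>
     (\<exists>e \<in> rat_tensor_carrier G. e \<notin> rat_tensor_null G H \<and>
        (\<forall>t \<in> rat_tensor_carrier G. \<exists>q. t - rat_tensor_scale q e \<in> rat_tensor_null G H))"

definition value_transcendental ::
  "('a::field \<Rightarrow> 'g::linordered_ab_group_add extended) \<Rightarrow> ('a poly fract \<Rightarrow> 'g extended) \<Rightarrow> bool" where
  "value_transcendental v w \<longleftrightarrow> rat_tensor_dim_one (value_group w) (value_group v)"


section \<open>Pseudo divergent sequences\<close>

text \<open>
  The index set is a nonempty well-ordered type without greatest element, i.e. an arbitrary
  limit ordinal.
\<close>

definition pseudo_divergent ::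
  "('f::field \<Rightarrow> 'g::linordered_ab_group_add extended) \<Rightarrow> ('i::{wellorder,no_top} \<Rightarrow> 'f) \<Rightarrow> bool" where
  "pseudo_divergent v z \<longleftrightarrow>
     (\<forall>\<nu>1 \<nu>2 \<nu>3. \<nu>1 < \<nu>2 \<and> \<nu>2 < \<nu>3 \<longrightarrow> v (z \<nu>1 - z \<nu>2) > v (z \<nu>2 - z \<nu>3))"

text \<open>Meaningful only if \<open>\<nu>\<close> is not the least index.\<close>

definition pds_delta ::
  "('f::field \<Rightarrow> 'g::linordered_ab_group_add extended) \<Rightarrow> ('i::{wellorder,no_top} \<Rightarrow> 'f) \<Rightarrow>
   'i \<Rightarrow> 'g extended" where
  "pds_delta v z \<nu> = (THE \<delta>. \<forall>\<mu><\<nu>. v (z \<nu> - z \<mu>) = \<delta>)"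

lemma pds_delta_eq:
  assumes "valuation v" "pseudo_divergent v z" "\<mu> < \<nu>"
  shows "pds_delta v z \<nu> = v (z \<nu> - z \<mu>)"
proof -
  have val_minus: "v (x - y) = v (y - x)" for x y
  proof -
    have m: "v (x * y) = v x + v y" and f: "v x \<noteq> Minf" and i: "v x = Pinf \<longleftrightarrow> x = 0" for x y
      using assms(1) by (auto simp: valuation_def)
    obtain g where g: "v (-1) = Fin g" using f[of "-1"] i[of "-1"] by (cases "v (-1)") auto
    obtain h where h: "v 1 = Fin h" using f[of 1] i[of 1] by (cases "v 1") auto
    have "h = 0" using m[of 1 1] h by simp
    hence "g + g = 0" using m[of "-1" "-1"] g h by simp
    hence "g = 0" by simp
    hence "v (- (y - x)) = v (y - x)" using m[of "-1" "y - x"] g by (simp flip: zero_extended_def)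
    thus ?thesis by simp
  qed
  have eq: "v (z \<nu> - z \<mu>') = v (z \<nu> - z \<kappa>)" if "\<mu>' < \<kappa>" "\<kappa> < \<nu>" for \<mu>' \<kappa>
  proof -
    have lt: "v (z \<kappa> - z \<nu>) < v (z \<mu>' - z \<kappa>)"
      using assms(2) that by (auto simp: pseudo_divergent_def)
    have tri: "min (v x) (v y) \<le> v (x + y)" for x y
      using assms(1) by (auto simp: valuation_def)
    have "min (v (z \<mu>' - z \<kappa>)) (v (z \<kappa> - z \<nu>)) \<le> v (z \<mu>' - z \<nu>)"
      using tri[of "z \<mu>' - z \<kappa>" "z \<kappa> - z \<nu>"] by simp
    with lt have "v (z \<kappa> - z \<nu>) \<le> v (z \<mu>' - z \<nu>)"
      by (simp add: min_absorb2 less_imp_le)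
    moreover have "min (v (z \<mu>' - z \<kappa>)) (v (z \<mu>' - z \<nu>)) \<le> v (z \<kappa> - z \<nu>)"
      using tri[of "z \<kappa> - z \<mu>'" "z \<mu>' - z \<nu>"] val_minus[of "z \<kappa>" "z \<mu>'"] by simp
    with lt have "v (z \<mu>' - z \<nu>) \<le> v (z \<kappa> - z \<nu>)"
      unfolding min_le_iff_disj by (meson not_le)
    ultimately show ?thesis
      unfolding val_minus[of "z \<nu>"] by (rule antisym[rotated])
  qed
  have all: "\<forall>\<mu>'<\<nu>. v (z \<nu> - z \<mu>') = v (z \<nu> - z \<mu>)"
  proof (intro allI impI)
    fix \<mu>' assume "\<mu>' < \<nu>"
    consider "\<mu>' < \<mu>" | "\<mu>' = \<mu>" | "\<mu> < \<mu>'" by (rule linorder_cases)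
    thus "v (z \<nu> - z \<mu>') = v (z \<nu> - z \<mu>)"
    proof cases
      case 1 thus ?thesis using assms(3) by (rule eq)
    next
      case 2 thus ?thesis by (simp only:)
    next
      case 3 thus ?thesis using \<open>\<mu>' < \<nu>\<close> by (rule eq[symmetric])
    qed
  qed
  show ?thesis unfolding pds_delta_def
    using all assms(3) by (intro the_equality) blast+
qed

text \<open>\<open>y\<close> lies in an extension field with valuation \<open>u\<close>, into which \<open>\<iota>\<close> embeds the base field.\<close>

definition pds_limit ::
  "('f::field \<Rightarrow> 'g::linordered_ab_group_add extended) \<Rightarrow> ('i::{wellorder,no_top} \<Rightarrow> 'f) \<Rightarrow>
   ('e::field \<Rightarrow> 'g extended) \<Rightarrow> ('f \<Rightarrow> 'e) \<Rightarrow> 'e \<Rightarrow> bool" where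
  "pds_limit v z u \<iota> y \<longleftrightarrow> (\<forall>\<^sub>F \<nu> in at_top. u (y - \<iota> (z \<nu>)) = pds_delta v z \<nu>)"

text \<open>
  The valuation ring of \<open>v\<^sub>E\<close>. A rational function has a pole at \<open>z \<nu>\<close> only for finitely many \<open>\<nu>\<close>,
  so \<open>ratfun_eval\<close> is used at regular points only.
\<close>

definition pds_valuation_ring ::
  "('f::field \<Rightarrow> 'g::linordered_ab_group_add extended) \<Rightarrow> ('i::{wellorder,no_top} \<Rightarrow> 'f) \<Rightarrow>
   'f poly fract set" where
  "pds_valuation_ring v z = {\<phi>. \<forall>\<^sub>F \<nu> in at_top. v (ratfun_eval \<phi> (z \<nu>)) \<ge> 0}"


section \<open>Pairs of definition\<close>

definition common_extension ::
  "('a::field poly fract \<Rightarrow> 'g::linordered_ab_group_add extended) \<Rightarrow>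
   ('a alg_closure \<Rightarrow> 'g extended) \<Rightarrow> ('a alg_closure poly fract \<Rightarrow> 'g extended) \<Rightarrow> bool" where
  "common_extension w vbar wbar \<longleftrightarrow>
     valuation wbar \<and> extends_along ratfun_to_ac w wbar \<and> extends_along ratfun_const vbar wbar"

text \<open>
  \<open>u\<close> is the valuation written \<open>v\<^bsub>a,\<alpha>\<^esub>\<close>. The formula fixes \<open>u\<close> on all polynomials, hence on all
  rational functions. The constant sum is the multiple \<open>i \<alpha>\<close>.
\<close>

definition is_monomial_valuation ::
  "('f::field \<Rightarrow> 'g::linordered_ab_group_add extended) \<Rightarrow> 'f \<Rightarrow> 'g extended \<Rightarrow>
   ('f poly fract \<Rightarrow> 'g extended) \<Rightarrow> bool" where
  "is_monomial_valuation v a \<alpha> u \<longleftrightarrow> valuation u \<and>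
     (\<forall>n c. u (\<Sum>i\<le>n. ratfun_const (c i) * (ratfun_X - ratfun_const a) ^ i) =
            Min ((\<lambda>i. v (c i) + (\<Sum>_<i. \<alpha>)) ` {..n}))"

definition pair_of_definition ::
  "('a::field alg_closure \<Rightarrow> 'g::linordered_ab_group_add extended) \<Rightarrow>
   ('a alg_closure poly fract \<Rightarrow> 'g extended) \<Rightarrow> 'a alg_closure \<Rightarrow> 'g extended \<Rightarrow> bool" where
  "pair_of_definition vbar wbar a \<alpha> \<longleftrightarrow>
     \<alpha> \<in> Fin ` value_group wbar \<and> is_monomial_valuation vbar a \<alpha> wbar"

end

theory Submission
  imports Defs
begin

text \<open>
  Since \<open>X\<close> is not a limit of \<open>E\<close>, the value \<open>\<gamma> = w(X - z\<^sub>\<mu>)\<close> does not depend on \<open>\<mu>\<close> and lies below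
  every \<open>\<delta>\<^sub>\<nu>\<close>. All three conditions are equivalent to \<open>\<gamma>\<close> realising the cut in \<open>vbar\<close>'s value group
  whose lower part consists of the \<open>\<beta>\<close> below all \<open>\<delta>\<^sub>\<nu>\<close>. Given the cut, \<open>\<gamma>\<close> is not torsion over that
  (divisible) group, so the monomials in \<open>X - z\<^sub>\<mu>\<close> have distinct \<open>w\<close>-values and the Gauss valuation at
  \<open>(z\<^sub>\<mu>, \<gamma>)\<close> is a common extension of \<open>w\<close> and \<open>vbar\<close>. Splitting a polynomial into linear factors,
  its value at \<open>z\<^sub>\<nu>\<close> is eventually \<open>B + k \<delta>\<^sub>\<nu>\<close> while its \<open>w\<close>-value is \<open>B + k \<gamma>\<close>, where \<open>k\<close> counts the
  roots that are limits of \<open>E\<close>; the cut makes the signs of the two agree. Conversely, a failure of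
  the cut gives a \<open>\<beta> \<ge> \<gamma>\<close> below all \<open>\<delta>\<^sub>\<nu>\<close>. If \<open>w = v\<^sub>E\<close>, it is refuted by comparing
  \<open>(X - z\<^sub>\<mu>)\<^sup>n\<close> with a constant of value \<open>n \<beta>\<close>; under (ii), by any \<open>z\<^sub>\<mu> + b\<close> with \<open>b\<close> of value
  \<open>\<beta>\<close>, which is the centre of a pair of definition but not a limit.
\<close>

section \<open>Valuations on integral domains\<close>

text \<open>The constant sum matches the multiple \<open>i \<alpha>\<close> in
  \<open>is_monomial_valuation\<close>, and it makes sense both in \<open>'g\<close> and in
  \<open>'g extended\<close>.\<close>

abbreviation ntimes :: "nat \<Rightarrow> 'b::comm_monoid_add \<Rightarrow> 'b" where
  "ntimes n x \<equiv> (\<Sum>_<n. x)"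

lemma ntimes_add: "ntimes (m + n) x = ntimes m x + ntimes n x"
  by (induction n) (simp_all add: add.assoc)

lemma ntimes_Fin: "ntimes n (Fin x) = Fin (ntimes n x)"
  by (induction n) (simp_all add: zero_extended_def)

lemma ntimes_mono:
  fixes x y :: "'g::linordered_ab_group_add"
  shows "x \<le> y \<Longrightarrow> ntimes n x \<le> ntimes n y"
  by (rule sum_mono)

lemma ntimes_less_iff:
  fixes x y :: "'g::linordered_ab_group_add"
  assumes "n > 0"
  shows "ntimes n x < ntimes n y \<longleftrightarrow> x < y"
proof -
  have "ntimes n x < ntimes n y" if "x < y" for x y :: 'g
    using assms that by (intro sum_strict_mono) auto
  with ntimes_mono show ?thesis by (metis not_le)
qed

lemma ntimes_le_iff:
  fixes x y :: "'g::linordered_ab_group_add"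
  assumes "n > 0"
  shows "ntimes n x \<le> ntimes n y \<longleftrightarrow> x \<le> y"
  using ntimes_less_iff[OF assms] by (metis not_le)

lemma extended_add_less_le_mono:
  fixes a b c d :: "'g::linordered_ab_group_add extended"
  assumes "a < b" "c \<le> d" "c \<noteq> Pinf" "c \<noteq> Minf" "a \<noteq> Minf"
  shows "a + c < b + d"
  using assms by (cases a; cases b; cases c; cases d) (auto simp: add_less_le_mono)

text \<open>Stated over an integral domain so that one calculus serves valued fields and also
  polynomial rings under a Gauss valuation.\<close>

locale domain_valuation =
  fixes v :: "'r::idom \<Rightarrow> 'g::linordered_ab_group_add extended"
  assumes eq_Pinf_iff [simp]: "v x = Pinf \<longleftrightarrow> x = 0"
    and neq_Minf [simp]: "v x \<noteq> Minf"
    and mult: "v (x * y) = v x + v y"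
    and add_ge: "min (v x) (v y) \<le> v (x + y)"

lemma valuation_iff_domain_valuation: "valuation v \<longleftrightarrow> domain_valuation v"
  by (auto simp: valuation_def domain_valuation_def)

context domain_valuation
begin

lemma zero [simp]: "v 0 = Pinf"
  by simp

lemma FinE:
  assumes "x \<noteq> 0"
  obtains g where "v x = Fin g"
  using assms eq_Pinf_iff[of x] neq_Minf[of x] by (cases "v x") auto

lemma one [simp]: "v 1 = 0"
proof -
  obtain g where g: "v 1 = Fin g" using FinE[of 1] by auto
  thus ?thesis using mult[of 1 1] by (simp add: zero_extended_def)
qed

lemma minus [simp]: "v (- x) = v x"
proof -
  obtain g where g: "v (- 1) = Fin g" using FinE[of "- 1"] by auto
  have "g = 0" using mult[of "- 1" "- 1"] g by (simp add: zero_extended_def)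
  thus ?thesis using mult[of "- 1" x] g by (simp flip: zero_extended_def)
qed

lemma minus_commute: "v (x - y) = v (y - x)"
  using minus[of "x - y"] by simp

lemma power: "v (x ^ n) = ntimes n (v x)"
  by (induction n) (simp_all add: mult add.commute)

lemma add_eq_left:
  assumes "v x < v y"
  shows "v (x + y) = v x"
proof (rule antisym)
  show "v x \<le> v (x + y)" using add_ge[of x y] assms by (simp add: min_absorb1)
  have "min (v (x + y)) (v y) \<le> v x" using add_ge[of "x + y" "- y"] by simp
  thus "v (x + y) \<le> v x" using assms by (auto simp: min_le_iff_disj)
qed

lemma add_eq_right: "v y < v x \<Longrightarrow> v (x + y) = v y"
  using add_eq_left[of y x] by (simp add: add.commute)

lemma sum_ge:
  assumes "\<And>i. i \<in> I \<Longrightarrow> t \<le> v (f i)"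
  shows "t \<le> v (\<Sum>i\<in>I. f i)"
  using assms
proof (induction I rule: infinite_finite_induct)
  case (insert i I)
  thus ?case using add_ge[of "f i" "sum f I"] by (auto intro: order_trans[rotated])
qed simp_all

text \<open>The bound \<open>t \<noteq> Pinf\<close> covers the empty sum, whose value is
  \<open>Pinf\<close>.\<close>

lemma sum_gt:
  assumes "\<And>i. i \<in> I \<Longrightarrow> t < v (f i)" "t \<noteq> Pinf"
  shows "t < v (\<Sum>i\<in>I. f i)"
  using assms
proof (induction I rule: infinite_finite_induct)
  case (insert i I)
  thus ?case using add_ge[of "f i" "sum f I"] by (auto intro: less_le_trans[rotated])
qed (auto simp: less_le)

lemma sum_dominated:
  assumes "finite I" "i \<in> I" "\<And>j. j \<in> I \<Longrightarrow> j \<noteq> i \<Longrightarrow> v (f i) < v (f j)" "f i \<noteq> 0"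
  shows "v (\<Sum>i\<in>I. f i) = v (f i)"
proof -
  have "v (f i) < v (\<Sum>j\<in>I - {i}. f j)"
    using assms by (intro sum_gt) auto
  thus ?thesis using assms by (simp add: sum.remove add_eq_left)
qed

text \<open>A summand of least value is unique unless it is zero, so it dominates the rest. Zero
  summands all share the value \<open>Pinf\<close>, hence distinctness is asked only for nonzero
  ones.\<close>

lemma sum_distinct_values:
  assumes "finite I" "I \<noteq> {}"
    and "\<And>i j. i \<in> I \<Longrightarrow> j \<in> I \<Longrightarrow> i \<noteq> j \<Longrightarrow> f i \<noteq> 0 \<Longrightarrow> v (f i) \<noteq> v (f j)"
  shows "v (\<Sum>i\<in>I. f i) = Min ((\<lambda>i. v (f i)) ` I)"
proof -
  let ?m = "Min ((\<lambda>i. v (f i)) ` I)"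
  have "?m \<in> (\<lambda>i. v (f i)) ` I" using assms by (intro Min_in) auto
  then obtain i where i: "i \<in> I" "v (f i) = ?m" by auto
  have le: "v (f i) \<le> v (f j)" if "j \<in> I" for j
    unfolding i(2) using that assms by (intro Min_le) auto
  show ?thesis
  proof (cases "f i = 0")
    case True
    hence "f j = 0" if "j \<in> I" for j using le[OF that] by simp
    thus ?thesis using i True by simp
  next
    case False
    have "v (f i) < v (f j)" if "j \<in> I" "j \<noteq> i" for j
      using le[of j] assms(3)[of i j] that i False by (auto simp: less_le)
    thus ?thesis using sum_dominated[of I i f] assms(1) i False by simp
  qed
qed

end

section \<open>Gauss valuations\<close>

lemma pcompose_linear_inverse:
  fixes p :: "'r::comm_ring_1 poly"
  shows "p \<circ>\<^sub>p [:a, 1:] \<circ>\<^sub>p [:- a, 1:] = p" "p \<circ>\<^sub>p [:- a, 1:] \<circ>\<^sub>p [:a, 1:] = p"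
  by (simp_all flip: pcompose_assoc add: pcompose_pCons)

text \<open>The Gauss valuation centred at 0 that gives the indeterminate the value
  \<open>\<gamma>\<close>; a centre \<open>a\<close> is reached by first substituting
  \<open>[:a, 1:]\<close>.\<close>

definition gauss :: "('r::idom \<Rightarrow> 'g::linordered_ab_group_add extended) \<Rightarrow> 'g \<Rightarrow> 'r poly \<Rightarrow> 'g extended"
  where "gauss v \<gamma> p =
    Min ((\<lambda>i. v (Polynomial.coeff p i) + Fin (ntimes i \<gamma>)) ` {..Polynomial.degree p})"

context domain_valuation
begin

abbreviation gterm :: "'g \<Rightarrow> 'r poly \<Rightarrow> nat \<Rightarrow> 'g extended" where
  "gterm \<gamma> p i \<equiv> v (Polynomial.coeff p i) + Fin (ntimes i \<gamma>)"

lemma gterm_neq_Minf [simp]: "gterm \<gamma> p i \<noteq> Minf"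
  using neq_Minf[of "Polynomial.coeff p i"] by (cases "v (Polynomial.coeff p i)") auto

lemma gterm_eq_Pinf_iff [simp]: "gterm \<gamma> p i = Pinf \<longleftrightarrow> Polynomial.coeff p i = 0"
  unfolding eq_Pinf_iff[symmetric] by (cases "v (Polynomial.coeff p i)") auto

text \<open>Coefficients beyond the degree contribute \<open>Pinf\<close>, so the minimum may be
  read over all indices. Most later estimates go through this form.\<close>

lemma le_gauss_iff: "t \<le> gauss v \<gamma> p \<longleftrightarrow> (\<forall>i. t \<le> gterm \<gamma> p i)"
proof -
  have "t \<le> gterm \<gamma> p i" if "\<forall>i\<in>{..Polynomial.degree p}. t \<le> gterm \<gamma> p i" for i
    using that by (cases "i \<le> Polynomial.degree p") (auto simp: coeff_eq_0)
  thus ?thesis unfolding gauss_def by (auto simp: Min_ge_iff)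
qed

lemma gauss_le: "gauss v \<gamma> p \<le> gterm \<gamma> p i"
  using le_gauss_iff[of "gauss v \<gamma> p"] by blast

lemma gauss_attained: "\<exists>i. gauss v \<gamma> p = gterm \<gamma> p i"
proof -
  have "gauss v \<gamma> p \<in> (gterm \<gamma> p) ` {..Polynomial.degree p}"
    unfolding gauss_def by (intro Min_in) auto
  thus ?thesis by auto
qed

lemma gauss_neq_Minf: "gauss v \<gamma> p \<noteq> Minf"
  using gauss_attained[of \<gamma> p] gterm_neq_Minf by metis

lemma gauss_const [simp]: "gauss v \<gamma> [:c:] = v c"
  by (simp add: gauss_def flip: zero_extended_def)

lemma gauss_linear: "gauss v \<gamma> [:b, 1:] = min (v b) (Fin \<gamma>)"
proof -
  have "{..Polynomial.degree [:b, 1:]} = {0, 1}" by auto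
  thus ?thesis by (simp add: gauss_def flip: zero_extended_def)
qed

lemma gauss_eq_Pinf_iff: "gauss v \<gamma> p = Pinf \<longleftrightarrow> p = 0"
proof
  assume "gauss v \<gamma> p = Pinf"
  thus "p = 0" using gauss_le[of \<gamma> p] by (intro poly_eqI) auto
qed (simp add: gauss_def)

lemma gauss_zero [simp]: "gauss v \<gamma> 0 = Pinf"
  by (simp add: gauss_eq_Pinf_iff)

lemma gauss_mult_ge: "gauss v \<gamma> p + gauss v \<gamma> q \<le> gauss v \<gamma> (p * q)"
  unfolding le_gauss_iff
proof
  fix n
  show "gauss v \<gamma> p + gauss v \<gamma> q \<le> gterm \<gamma> (p * q) n"
  proof -
    have eq: "Fin (ntimes n \<gamma>) = Fin (ntimes i \<gamma>) + Fin (ntimes (n - i) \<gamma>)" if "i \<le> n" for i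
      using ntimes_add[of \<gamma> i "n - i"] that by simp
    \<comment> \<open>The monomial part is moved to the left so that \<open>sum_ge\<close> applies
      to the bare convolution sum; it is moved back at the end.\<close>
    have "gauss v \<gamma> p + gauss v \<gamma> q + Fin (- ntimes n \<gamma>) \<le> v (Polynomial.coeff (p * q) n)"
      unfolding coeff_mult
    proof (rule sum_ge)
      fix i assume "i \<in> {..n}"
      hence "i \<le> n" by simp
      have "gauss v \<gamma> p + gauss v \<gamma> q \<le> gterm \<gamma> p i + gterm \<gamma> q (n - i)"
        by (intro add_mono gauss_le)
      also have "\<dots> = v (Polynomial.coeff p i * Polynomial.coeff q (n - i)) + Fin (ntimes n \<gamma>)"
        unfolding eq[OF \<open>i \<le> n\<close>] mult by (simp only: ac_simps)
      finally have "gauss v \<gamma> p + gauss v \<gamma> q + Fin (- ntimes n \<gamma>)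
          \<le> v (Polynomial.coeff p i * Polynomial.coeff q (n - i)) + Fin (ntimes n \<gamma>) + Fin (- ntimes n \<gamma>)"
        by (rule add_right_mono)
      thus "gauss v \<gamma> p + gauss v \<gamma> q + Fin (- ntimes n \<gamma>)
          \<le> v (Polynomial.coeff p i * Polynomial.coeff q (n - i))"
        by (simp add: add.assoc flip: zero_extended_def)
    qed
    from add_right_mono[OF this, of "Fin (ntimes n \<gamma>)"] show ?thesis
      by (simp add: add.assoc flip: zero_extended_def)
  qed
qed

text \<open>Singles out the first index attaining the minimum, which is what isolates one dominant
  term in a product.\<close>

lemma gauss_least_index:
  assumes "p \<noteq> 0"
  obtains i where "gauss v \<gamma> p = gterm \<gamma> p i" "\<And>j. j < i \<Longrightarrow> gauss v \<gamma> p < gterm \<gamma> p j"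
proof -
  let ?P = "\<lambda>i. gauss v \<gamma> p = gterm \<gamma> p i"
  have "?P (Least ?P)" using gauss_attained by (rule LeastI_ex)
  moreover have "gauss v \<gamma> p < gterm \<gamma> p j" if "j < Least ?P" for j
    using not_less_Least[OF that] gauss_le[of \<gamma> p j] by (simp add: less_le)
  ultimately show ?thesis by (rule that)
qed

text \<open>The argument of Gauss's lemma: if \<open>i\<close> and \<open>j\<close> are the least
  minimising indices of \<open>p\<close> and \<open>q\<close>, the term \<open>(i, j)\<close>
  strictly dominates the coefficient of the product at \<open>i + j\<close>, so the lower bound is
  attained there.\<close>

lemma gauss_mult: "gauss v \<gamma> (p * q) = gauss v \<gamma> p + gauss v \<gamma> q"
proof (cases "p = 0 \<or> q = 0")
  case True
  from True show ?thesis
    using gauss_neq_Minf[of \<gamma> p] gauss_neq_Minf[of \<gamma> q]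
    by (cases "gauss v \<gamma> p"; cases "gauss v \<gamma> q") auto
next
  case False
  obtain i where i: "gauss v \<gamma> p = gterm \<gamma> p i" "\<And>k. k < i \<Longrightarrow> gauss v \<gamma> p < gterm \<gamma> p k"
    using gauss_least_index[where p = p and \<gamma> = \<gamma>] False by blast
  obtain j where j: "gauss v \<gamma> q = gterm \<gamma> q j" "\<And>k. k < j \<Longrightarrow> gauss v \<gamma> q < gterm \<gamma> q k"
    using gauss_least_index[where p = q and \<gamma> = \<gamma>] False by blast
  have nz: "Polynomial.coeff p i \<noteq> 0" "Polynomial.coeff q j \<noteq> 0"
    using False i(1) j(1) gauss_eq_Pinf_iff[of \<gamma>] by (metis gterm_eq_Pinf_iff)+
  have eq: "v (Polynomial.coeff p k * Polynomial.coeff q (i + j - k)) + Fin (ntimes (i + j) \<gamma>)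
      = gterm \<gamma> p k + gterm \<gamma> q (i + j - k)" if "k \<le> i + j" for k
  proof -
    have *: "Fin (ntimes (i + j) \<gamma>) = Fin (ntimes k \<gamma>) + Fin (ntimes (i + j - k) \<gamma>)"
      using ntimes_add[of \<gamma> k "i + j - k"] that by simp
    show ?thesis unfolding mult * by (simp only: ac_simps)
  qed
  let ?f = "\<lambda>k. Polynomial.coeff p k * Polynomial.coeff q (i + j - k)"
  have "v (\<Sum>k\<le>i + j. ?f k) = v (?f i)"
  proof (rule sum_dominated)
    \<comment> \<open>Any other pair has \<open>k < i\<close> or \<open>i + j - k < j\<close>, so
      one factor lies strictly above its minimum and the other not below.\<close>
    fix k assume k: "k \<in> {..i + j}" "k \<noteq> i"
    have "gterm \<gamma> p i + gterm \<gamma> q j < gterm \<gamma> p k + gterm \<gamma> q (i + j - k)"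
    proof (cases "k < i")
      case True
      thus ?thesis using i(2)[of k] gauss_le[of \<gamma> q "i + j - k"] nz unfolding i(1) j(1)
        by - (rule extended_add_less_le_mono; simp)
    next
      case False
      hence "i + j - k < j" using k by auto
      hence "gterm \<gamma> q j + gterm \<gamma> p i < gterm \<gamma> q (i + j - k) + gterm \<gamma> p k"
        using j(2)[of "i + j - k"] gauss_le[of \<gamma> p k] nz unfolding i(1) j(1)
        by - (rule extended_add_less_le_mono; simp)
      thus ?thesis by (simp only: add.commute)
    qed
    hence *: "v (?f i) + Fin (ntimes (i + j) \<gamma>) < v (?f k) + Fin (ntimes (i + j) \<gamma>)"
      using eq[of i] eq[of k] k by simp
    thus "v (?f i) < v (?f k)" using add_right_mono by (metis not_le)
  qed (use nz in auto)
  hence "gterm \<gamma> (p * q) (i + j) = gauss v \<gamma> p + gauss v \<gamma> q"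
    using eq[of i] i(1) j(1) by (simp add: coeff_mult)
  thus ?thesis using gauss_le[of \<gamma> "p * q" "i + j"] gauss_mult_ge[of \<gamma> p q] by simp
qed

lemma gauss_add_ge: "min (gauss v \<gamma> p) (gauss v \<gamma> q) \<le> gauss v \<gamma> (p + q)"
  unfolding le_gauss_iff
proof
  fix i
  have "min (gauss v \<gamma> p) (gauss v \<gamma> q) \<le> min (gterm \<gamma> p i) (gterm \<gamma> q i)"
    by (intro min.mono gauss_le)
  also have "\<dots> = min (v (Polynomial.coeff p i)) (v (Polynomial.coeff q i)) + Fin (ntimes i \<gamma>)"
    by (cases "v (Polynomial.coeff p i)"; cases "v (Polynomial.coeff q i)") (auto simp: min_def)
  also have "\<dots> \<le> gterm \<gamma> (p + q) i"
    by (simp add: add_ge add_right_mono)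
  finally show "min (gauss v \<gamma> p) (gauss v \<gamma> q) \<le> gterm \<gamma> (p + q) i" .
qed

lemma domain_valuation_gauss: "domain_valuation (gauss v \<gamma>)"
proof
qed (rule gauss_neq_Minf gauss_eq_Pinf_iff gauss_mult gauss_add_ge)+

text \<open>Under the hypothesis \<open>X + b\<close> still has value \<open>\<gamma>\<close>, so
  each term of the expansion in powers of \<open>X + b\<close> has the value of the corresponding
  term of \<open>p\<close>.\<close>

lemma gauss_pcompose_ge:
  assumes "Fin \<gamma> \<le> v b"
  shows "gauss v \<gamma> p \<le> gauss v \<gamma> (p \<circ>\<^sub>p [:b, 1:])"
proof -
  interpret G: domain_valuation "gauss v \<gamma>" by (rule domain_valuation_gauss)
  have "p \<circ>\<^sub>p [:b, 1:] = (\<Sum>i\<le>Polynomial.degree p. [:Polynomial.coeff p i:] * [:b, 1:] ^ i)"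
    unfolding pcompose_altdef poly_altdef by (simp add: degree_map_poly coeff_map_poly)
  moreover have "gauss v \<gamma> p \<le> gauss v \<gamma> ([:Polynomial.coeff p i:] * [:b, 1:] ^ i)" for i
    using gauss_le[of \<gamma> p i] assms
    by (simp only: G.mult G.power gauss_const gauss_linear min_absorb2 ntimes_Fin)
  ultimately show ?thesis by (simp only:) (rule G.sum_ge)
qed

text \<open>Translation by \<open>- b\<close> undoes translation by \<open>b\<close> and satisfies
  the same hypothesis, so the inequality holds both ways.\<close>

lemma gauss_pcompose:
  assumes "Fin \<gamma> \<le> v b"
  shows "gauss v \<gamma> (p \<circ>\<^sub>p [:b, 1:]) = gauss v \<gamma> p"
proof (rule antisym)
  show "gauss v \<gamma> (p \<circ>\<^sub>p [:b, 1:]) \<le> gauss v \<gamma> p"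
    using gauss_pcompose_ge[of \<gamma> "- b" "p \<circ>\<^sub>p [:b, 1:]"] assms
    by (simp add: pcompose_linear_inverse)
qed (rule gauss_pcompose_ge[OF assms])

end

section \<open>Valuations on fraction fields\<close>

lemma sum_Fract: "(\<Sum>i\<in>I. Fract (f i) 1) = Fract (\<Sum>i\<in>I. f i) 1"
  by (induction I rule: infinite_finite_induct) (simp_all flip: Zero_fract_def)

lemma power_Fract: "Fract p 1 ^ n = Fract (p ^ n) 1"
  by (induction n) (simp_all flip: One_fract_def)

text \<open>Determines the value of a quotient from numerator and denominator without subtracting in
  \<open>'g extended\<close>.\<close>

lemma domain_valuation_Fract:
  fixes u :: "'r::idom fract \<Rightarrow> 'g::linordered_ab_group_add extended"
  assumes "domain_valuation u" "q \<noteq> 0"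
  shows "u (Fract p 1) = u (Fract p q) + u (Fract q 1)"
proof -
  interpret domain_valuation u by fact
  have "Fract p 1 = Fract p q * Fract q 1" using assms(2) by (simp add: eq_fract)
  thus ?thesis by (simp only: mult)
qed

text \<open>A fraction gets the value of its numerator minus that of its denominator, for a chosen
  representative; multiplicativity of \<open>m\<close> makes the choice irrelevant.\<close>

lemma domain_valuation_extends_to_fract:
  fixes m :: "'r::idom \<Rightarrow> 'g::linordered_ab_group_add extended"
  assumes "domain_valuation m"
  obtains u where "valuation u" "\<And>p. u (Fract p 1) = m p"
proof -
  interpret domain_valuation m by fact
  have "\<forall>\<phi> :: 'r fract. \<exists>pq. \<phi> = Fract (fst pq) (snd pq) \<and> snd pq \<noteq> 0"
    by (metis Fract_cases fst_conv snd_conv)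
  then obtain r where r: "\<And>\<phi> :: 'r fract. \<phi> = Fract (fst (r \<phi>)) (snd (r \<phi>)) \<and> snd (r \<phi>) \<noteq> 0"
    by metis
  define u where "u = (\<lambda>\<phi>. m (fst (r \<phi>)) - m (snd (r \<phi>)))"
  have u: "u (Fract p q) = m p - m q" if "q \<noteq> 0" for p q
  proof -
    obtain p' q' where pq': "r (Fract p q) = (p', q')" by force
    have q': "q' \<noteq> 0" "Fract p q = Fract p' q'" using r[of "Fract p q"] pq' by auto
    hence "p * q' = p' * q" using that by (simp add: eq_fract)
    hence *: "m p + m q' = m p' + m q" by (metis mult)
    obtain a where a: "m q = Fin a" using FinE[OF \<open>q \<noteq> 0\<close>] .
    obtain b where b: "m q' = Fin b" using FinE[OF q'(1)] .
    have "m p - m q = m p' - m q'"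
      using * neq_Minf[of p] neq_Minf[of p'] unfolding a b
      by (cases "m p"; cases "m p'") (simp_all add: algebra_simps)
    thus ?thesis by (simp add: u_def pq')
  qed
  show ?thesis
  proof
    show u1: "u (Fract p 1) = m p" for p
      using neq_Minf[of p] by (cases "m p") (simp_all add: u zero_extended_def)
    show "valuation u"
      unfolding valuation_iff_domain_valuation
    proof
      fix \<phi> \<psi> :: "'r fract"
      obtain p q where pq: "\<phi> = Fract p q" "q \<noteq> 0" by (cases \<phi>)
      obtain p' q' where pq': "\<psi> = Fract p' q'" "q' \<noteq> 0" by (cases \<psi>)
      obtain b where b: "m q = Fin b" using FinE[OF pq(2)] .
      obtain b' where b': "m q' = Fin b'" using FinE[OF pq'(2)] .
      show "u \<phi> = Pinf \<longleftrightarrow> \<phi> = 0"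
        using neq_Minf[of p] eq_Pinf_iff[of p] b pq
        by (cases "m p") (auto simp: u Zero_fract_def eq_fract)
      show "u \<phi> \<noteq> Minf"
        using neq_Minf[of p] b pq by (cases "m p") (auto simp: u)
      show "u (\<phi> * \<psi>) = u \<phi> + u \<psi>"
        using neq_Minf[of p] neq_Minf[of p'] b b' pq pq'
        by (cases "m p"; cases "m p'") (auto simp: u mult)
      \<comment> \<open>The ultrametric inequality for the numerators over the common denominator
        \<open>q * q'\<close>.\<close>
      have "min (m p + m q') (m p' + m q) \<le> m (p * q' + p' * q)"
        using add_ge[of "p * q'" "p' * q"] by (simp add: mult)
      thus "min (u \<phi>) (u \<psi>) \<le> u (\<phi> + \<psi>)"
        using neq_Minf[of p] neq_Minf[of p'] neq_Minf[of "p * q' + p' * q"] b b' pq pq'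
        unfolding min_le_iff_disj
        by (cases "m p"; cases "m p'"; cases "m (p * q' + p' * q)")
           (auto simp: u mult algebra_simps)
    qed
  qed
qed

section \<open>Monomial valuations as recentred Gauss valuations\<close>

lemma pcompose_monom_eq: "Polynomial.monom c i \<circ>\<^sub>p q = smult c (q ^ i)"
  for q :: "'r::comm_ring_1 poly"
  by (induction i) (simp_all add: monom_0 monom_Suc pcompose_pCons)

lemma ratfun_X_diff_const: "ratfun_X - ratfun_const a = Fract [:- a, 1:] 1"
  by (simp add: ratfun_X_def ratfun_const_def)

lemma Fract_pcompose_linear:
  fixes c :: "nat \<Rightarrow> 'f::field"
  shows "(\<Sum>i\<le>n. ratfun_const (c i) * (ratfun_X - ratfun_const a) ^ i) =
    Fract ((\<Sum>i\<le>n. Polynomial.monom (c i) i) \<circ>\<^sub>p [:- a, 1:]) 1"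
  unfolding ratfun_X_diff_const pcompose_sum pcompose_monom_eq
  by (simp add: ratfun_const_def power_Fract sum_Fract)

text \<open>The substitutions \<open>X + a\<close> and \<open>X - a\<close> are inverse to each
  other, so finite expansions around \<open>a\<close> range over all polynomials, and the minimum in
  the definition is the Gauss value after recentring.\<close>

lemma is_monomial_valuation_iff:
  fixes v :: "'f::field \<Rightarrow> 'g::linordered_ab_group_add extended"
  assumes "valuation v"
  shows "is_monomial_valuation v a (Fin \<gamma>) u \<longleftrightarrow>
    valuation u \<and> (\<forall>p. u (Fract p 1) = gauss v \<gamma> (p \<circ>\<^sub>p [:a, 1:]))"
proof -
  interpret domain_valuation v using assms by (simp add: valuation_iff_domain_valuation)
  have Min_eq: "Min ((\<lambda>i. v (c i) + (\<Sum>_<i. Fin \<gamma>)) ` {..n}) =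
      gauss v \<gamma> (\<Sum>i\<le>n. Polynomial.monom (c i) i)" for n c
  proof -
    have "gterm \<gamma> (\<Sum>i\<le>n. Polynomial.monom (c i) i) i =
        (if i \<le> n then v (c i) + Fin (ntimes i \<gamma>) else Pinf)" for i
      by (simp add: coeff_sum)
    \<comment> \<open>The degree may be smaller than \<open>n\<close>; surplus terms are
      \<open>Pinf\<close>, so the two minima are compared through their lower bounds.\<close>
    hence *: "t \<le> Min ((\<lambda>i. v (c i) + (\<Sum>_<i. Fin \<gamma>)) ` {..n}) \<longleftrightarrow>
        t \<le> gauss v \<gamma> (\<Sum>i\<le>n. Polynomial.monom (c i) i)" for t
      unfolding le_gauss_iff ntimes_Fin by (subst Min_ge_iff) auto
    show ?thesis using * by (intro order_antisym) blast+
  qed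
  show ?thesis
  proof safe
    fix p
    assume u: "is_monomial_valuation v a (Fin \<gamma>) u"
    thus "valuation u" by (simp add: is_monomial_valuation_def)
    let ?q = "p \<circ>\<^sub>p [:a, 1:]"
    have "u (Fract ((\<Sum>i\<le>n. Polynomial.monom (c i) i) \<circ>\<^sub>p [:- a, 1:]) 1) =
        gauss v \<gamma> (\<Sum>i\<le>n. Polynomial.monom (c i) i)" for n c
      using u unfolding is_monomial_valuation_def Min_eq Fract_pcompose_linear by blast
    from this[of "Polynomial.coeff ?q" "Polynomial.degree ?q"]
    show "u (Fract p 1) = gauss v \<gamma> ?q"
      by (simp add: poly_as_sum_of_monoms pcompose_linear_inverse)
  next
    assume "valuation u" "\<forall>p. u (Fract p 1) = gauss v \<gamma> (p \<circ>\<^sub>p [:a, 1:])"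
    thus "is_monomial_valuation v a (Fin \<gamma>) u"
      unfolding is_monomial_valuation_def Min_eq Fract_pcompose_linear
      by (simp add: pcompose_linear_inverse)
  qed
qed

lemma is_monomial_valuation_exists:
  fixes v :: "'f::field \<Rightarrow> 'g::linordered_ab_group_add extended"
  assumes "valuation v"
  obtains u where "is_monomial_valuation v a (Fin \<gamma>) u"
proof -
  interpret domain_valuation v using assms by (simp add: valuation_iff_domain_valuation)
  interpret G: domain_valuation "gauss v \<gamma>" by (rule domain_valuation_gauss)
  have "domain_valuation (\<lambda>p. gauss v \<gamma> (p \<circ>\<^sub>p [:a, 1:]))"
    by standard (simp_all add: pcompose_eq_0_iff pcompose_mult pcompose_add G.mult G.add_ge)
  then obtain u where "valuation u" "\<And>p. u (Fract p 1) = gauss v \<gamma> (p \<circ>\<^sub>p [:a, 1:])"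
    by (rule domain_valuation_extends_to_fract) blast
  thus ?thesis using that is_monomial_valuation_iff[OF assms] by blast
qed

text \<open>The two recentrings differ by the translation by \<open>b - a\<close>, which the Gauss
  valuation does not see.\<close>

lemma is_monomial_valuation_shift:
  fixes v :: "'f::field \<Rightarrow> 'g::linordered_ab_group_add extended"
  assumes "valuation v" "is_monomial_valuation v a (Fin \<gamma>) u" "Fin \<gamma> \<le> v (b - a)"
  shows "is_monomial_valuation v b (Fin \<gamma>) u"
proof -
  interpret domain_valuation v using assms by (simp add: valuation_iff_domain_valuation)
  have "gauss v \<gamma> (p \<circ>\<^sub>p [:b, 1:]) = gauss v \<gamma> (p \<circ>\<^sub>p [:a, 1:])" for p
    using gauss_pcompose[OF assms(3), of "p \<circ>\<^sub>p [:a, 1:]"]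
    by (simp flip: pcompose_assoc add: pcompose_pCons)
  thus ?thesis using assms(2) by (simp add: is_monomial_valuation_iff[OF assms(1)])
qed

lemma is_monomial_valuation_linear:
  fixes v :: "'f::field \<Rightarrow> 'g::linordered_ab_group_add extended"
  assumes "valuation v" "is_monomial_valuation v a (Fin \<gamma>) u"
  shows "u (ratfun_X - ratfun_const b) = min (v (b - a)) (Fin \<gamma>)"
proof -
  interpret domain_valuation v using assms by (simp add: valuation_iff_domain_valuation)
  have "u (Fract [:- b, 1:] 1) = gauss v \<gamma> [:a - b, 1:]"
    using assms(2) by (simp add: is_monomial_valuation_iff[OF assms(1)] pcompose_pCons)
  thus ?thesis by (simp add: ratfun_X_diff_const gauss_linear minus_commute)
qed

section \<open>Value groups: torsion and divisibility\<close>

lemma value_groupI: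
  assumes "valuation v" "v x = Fin g"
  shows "g \<in> value_group v"
proof -
  have "v x \<noteq> Pinf" using assms(2) by simp
  hence "x \<noteq> 0" using assms(1) unfolding valuation_def by blast
  thus ?thesis using assms(2) by (auto simp: value_group_def)
qed

text \<open>Take \<open>b\<close> of value \<open>\<beta>\<close> and an algebraic equation for it.
  Since its monomials sum to zero, two nonzero ones share their value, and comparing them expresses
  a positive multiple of \<open>\<beta>\<close> as the value of a quotient of coefficients.\<close>

lemma value_group_alg_closure_torsion:
  fixes v :: "'a::field \<Rightarrow> 'g::linordered_ab_group_add extended"
  assumes "valuation vbar" "extends_along to_ac v vbar" "\<beta> \<in> value_group vbar"
  obtains n c where "n > 0" "c \<noteq> 0" "v c = Fin (ntimes n \<beta>)"
proof -
  interpret domain_valuation vbar using assms by (simp add: valuation_iff_domain_valuation)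
  have ext: "v x = vbar (to_ac x)" for x using assms(2) by (simp add: extends_along_def)
  obtain b where b: "b \<noteq> 0" "vbar b = Fin \<beta>" using assms(3) by (auto simp: value_group_def)
  obtain p :: "'a poly" where p: "p \<noteq> 0" "poly (map_poly to_ac p) b = 0"
    by (rule alg_closure_algebraic)
  let ?c = "Polynomial.coeff p"
  let ?f = "\<lambda>i. to_ac (?c i) * b ^ i"
  let ?I = "{..Polynomial.degree p}"
  have "(\<Sum>i\<in>?I. ?f i) = 0"
    using p(2) by (simp add: poly_altdef coeff_map_poly degree_map_poly)
  \<comment> \<open>The zero sum has value \<open>Pinf\<close>, while the leading monomial keeps the
    minimum below it.\<close>
  hence "vbar (\<Sum>i\<in>?I. ?f i) \<noteq> Min ((\<lambda>i. vbar (?f i)) ` ?I)"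
  proof -
    have "Min ((\<lambda>i. vbar (?f i)) ` ?I) \<le> vbar (?f (Polynomial.degree p))"
      by (intro Min_le) auto
    moreover have "vbar (?f (Polynomial.degree p)) \<noteq> Pinf" using p b by simp
    ultimately have "Min ((\<lambda>i. vbar (?f i)) ` ?I) \<noteq> Pinf" by (metis Pinf_le)
    thus ?thesis unfolding \<open>(\<Sum>i\<in>?I. ?f i) = 0\<close> zero by (rule not_sym)
  qed
  then obtain i j where ij: "i \<noteq> j" "?f i \<noteq> 0" "vbar (?f i) = vbar (?f j)"
    using sum_distinct_values[of ?I ?f] by auto
  note result = that
  \<comment> \<open>Stated for ordered indices and applied below to the pair in either
    order.\<close>
  have *: thesis if ij: "i < j" "?c i \<noteq> 0" "?c j \<noteq> 0" "vbar (?f i) = vbar (?f j)" for i j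
  proof (rule result)
    obtain g where g: "v (?c i / ?c j) = Fin g"
      using FinE[of "to_ac (?c i / ?c j)"] ij ext by auto
    obtain h where h: "vbar (?f j) = Fin h"
      using FinE[of "?f j"] ij b by auto
    have "b ^ j = b ^ i * b ^ (j - i)" using ij(1) by (simp flip: power_add)
    hence "to_ac (?c i / ?c j) * ?f j = ?f i * b ^ (j - i)" using ij(3) by simp
    hence "vbar (to_ac (?c i / ?c j)) + vbar (?f j) = vbar (?f i) + vbar (b ^ (j - i))"
      unfolding mult[symmetric] by simp
    hence "g + h = h + ntimes (j - i) \<beta>"
      using ij(4) g h b(2) by (simp add: power ntimes_Fin ext)
    thus "v (?c i / ?c j) = Fin (ntimes (j - i) \<beta>)" using g by simp
  qed (use ij in auto)
  have nz: "?c i \<noteq> 0" "?c j \<noteq> 0"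
    using ij(2) eq_Pinf_iff[of "?f i"] eq_Pinf_iff[of "?f j"] ij(3) by auto
  show thesis
    using *[of i j] *[of j i] ij(1,3) nz by (cases i j rule: linorder_cases) auto
qed

text \<open>An \<open>n\<close>-th root of an element of value \<open>\<beta>\<close> has the
  required value.\<close>

lemma value_group_divisible:
  fixes v :: "'f::alg_closed_field \<Rightarrow> 'g::linordered_ab_group_add extended"
  assumes "valuation v" "\<beta> \<in> value_group v" "n > 0"
  obtains \<beta>' where "\<beta>' \<in> value_group v" "\<beta> = ntimes n \<beta>'"
proof -
  interpret domain_valuation v using assms by (simp add: valuation_iff_domain_valuation)
  obtain b where b: "b \<noteq> 0" "v b = Fin \<beta>" using assms(2) by (auto simp: value_group_def)
  obtain c where c: "c ^ n = b" using nth_root_exists[OF assms(3)] by blast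
  hence "c \<noteq> 0" using b assms(3) by (auto simp: power_0_left)
  then obtain g where g: "v c = Fin g" by (rule FinE)
  show thesis
  proof (rule that)
    show "g \<in> value_group v" using g \<open>c \<noteq> 0\<close> by (auto simp: value_group_def)
    show "\<beta> = ntimes n g" using b(2) c g by (auto simp: power ntimes_Fin)
  qed
qed

lemma value_group_diff:
  fixes v :: "'f::field \<Rightarrow> 'g::linordered_ab_group_add extended"
  assumes "valuation v" "\<beta> \<in> value_group v" "\<beta>' \<in> value_group v"
  shows "\<beta> - \<beta>' \<in> value_group v"
proof -
  interpret domain_valuation v using assms by (simp add: valuation_iff_domain_valuation)
  obtain b c where bc: "b \<noteq> 0" "v b = Fin \<beta>" "c \<noteq> 0" "v c = Fin \<beta>'"
    using assms by (auto simp: value_group_def)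
  obtain g where g: "v (b / c) = Fin g" using FinE[of "b / c"] bc by auto
  have "v (b / c) + v c = v b" using bc(3) mult[of "b / c" c] by simp
  hence "g = \<beta> - \<beta>'" using bc g by (simp add: eq_diff_eq)
  thus ?thesis using g bc by (auto simp: value_group_def intro!: exI[of _ "b / c"])
qed

lemma value_group_add:
  fixes v :: "'f::field \<Rightarrow> 'g::linordered_ab_group_add extended"
  assumes "valuation v" "\<beta> \<in> value_group v" "\<beta>' \<in> value_group v"
  shows "\<beta> + \<beta>' \<in> value_group v"
proof -
  have "\<beta> + \<beta>' = \<beta> - ((\<beta> - \<beta>) - \<beta>')" by simp
  thus ?thesis using value_group_diff[OF assms(1)] assms(2,3) by metis
qed

section \<open>Pseudo divergent sequences and the cut\<close>

locale pds_setup = domain_valuation v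
  for v :: "'a::field \<Rightarrow> 'g::linordered_ab_group_add extended" +
  fixes z :: "'i::{wellorder,no_top} \<Rightarrow> 'a"
  assumes pds: "pseudo_divergent v z"
begin

abbreviation \<delta> :: "'i \<Rightarrow> 'g extended" where "\<delta> \<equiv> pds_delta v z"

lemma delta_eq: "\<mu> < \<nu> \<Longrightarrow> \<delta> \<nu> = v (z \<nu> - z \<mu>)"
  by (rule pds_delta_eq[OF _ pds]) (simp add: valuation_iff_domain_valuation domain_valuation_axioms)

text \<open>The index \<open>\<kappa>\<close> certifies that \<open>\<mu>\<close> is not the least
  index, where \<open>pds_delta\<close> has no meaning.\<close>

lemma delta_strict_antimono:
  assumes "\<kappa> < \<mu>" "\<mu> < \<nu>"
  shows "\<delta> \<nu> < \<delta> \<mu>"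
  using pds assms by (simp add: delta_eq minus_commute pseudo_divergent_def)

text \<open>If the first two members coincide, the first meaningful \<open>\<delta>\<close> is
  \<open>Pinf\<close>; strictly below an earlier one it is finite.\<close>

lemma eventually_delta_Fin: "\<forall>\<^sub>F \<nu> in at_top. \<exists>d. \<delta> \<nu> = Fin d"
proof -
  obtain \<kappa> \<mu> :: 'i where "\<kappa> < \<mu>" using gt_ex by blast
  have "\<exists>d. \<delta> \<nu> = Fin d" if "\<mu> < \<nu>" for \<nu>
    using delta_strict_antimono[OF \<open>\<kappa> < \<mu>\<close> that] neq_Minf[of "z \<nu> - z \<mu>"]
    unfolding delta_eq[OF that] by (cases "v (z \<nu> - z \<mu>)") auto
  thus ?thesis by (rule eventually_mono[OF eventually_gt_at_top])
qed

lemma delta_eventually_le: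
  assumes "\<kappa> < \<nu>" "\<delta> \<nu> \<le> t"
  shows "\<forall>\<^sub>F \<rho> in at_top. \<delta> \<rho> < t"
  using eventually_gt_at_top[of \<nu>]
proof eventually_elim
  case (elim \<rho>)
  from delta_strict_antimono[OF assms(1) elim] assms(2) show ?case by (rule less_le_trans)
qed

end

text \<open>Used for \<open>to_ac\<close> and for \<open>ratfun_const\<close>, so that one limit
  criterion serves elements of the algebraic closure and the indeterminate.\<close>

locale pds_extension = pds_setup v z
  for v :: "'a::field \<Rightarrow> 'g::linordered_ab_group_add extended"
    and z :: "'i::{wellorder,no_top} \<Rightarrow> 'a" +
  fixes u :: "'e::field \<Rightarrow> 'g extended" and \<iota> :: "'a \<Rightarrow> 'e"
  assumes valuation_u: "valuation u"
    and extends: "extends_along \<iota> v u"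
    and \<iota>_diff: "\<And>x y. \<iota> (x - y) = \<iota> x - \<iota> y"
begin

sublocale U: domain_valuation u
  using valuation_u by (simp add: valuation_iff_domain_valuation)

lemma u_\<iota>_diff: "u (\<iota> x - \<iota> y) = v (x - y)"
  using extends by (simp add: extends_along_def \<iota>_diff[symmetric])

text \<open>Limits are the points lying within some \<open>\<delta> \<nu>\<close> of an arbitrary
  fixed member. For a limit, \<open>y - z \<nu>\<close> and \<open>z \<nu> - z \<mu>\<close>
  eventually both have value \<open>\<delta> \<nu>\<close>. Conversely, once
  \<open>\<delta> \<rho>\<close> has dropped below the value of \<open>y - z \<mu>\<close>, the
  difference \<open>z \<mu> - z \<rho>\<close> dominates.\<close>

lemma pds_limit_iff:
  "pds_limit v z u \<iota> y \<longleftrightarrow> (\<exists>\<nu>. (\<exists>\<kappa>. \<kappa> < \<nu>) \<and> \<delta> \<nu> \<le> u (y - \<iota> (z \<mu>)))"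
proof
  assume "pds_limit v z u \<iota> y"
  hence "\<forall>\<^sub>F \<nu> in at_top. u (y - \<iota> (z \<nu>)) = \<delta> \<nu>" by (simp add: pds_limit_def)
  hence "\<forall>\<^sub>F \<nu> in at_top. \<mu> < \<nu> \<and> \<delta> \<nu> \<le> u (y - \<iota> (z \<mu>))"
    using eventually_gt_at_top[of \<mu>]
  proof eventually_elim
    case (elim \<nu>)
    thus ?case
      using U.add_ge[of "y - \<iota> (z \<nu>)" "\<iota> (z \<nu>) - \<iota> (z \<mu>)"] by (simp add: u_\<iota>_diff delta_eq)
  qed
  thus "\<exists>\<nu>. (\<exists>\<kappa>. \<kappa> < \<nu>) \<and> \<delta> \<nu> \<le> u (y - \<iota> (z \<mu>))"
    using eventually_happens'[OF trivial_limit_at_top_linorder] by blast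
next
  assume "\<exists>\<nu>. (\<exists>\<kappa>. \<kappa> < \<nu>) \<and> \<delta> \<nu> \<le> u (y - \<iota> (z \<mu>))"
  then obtain \<nu> \<kappa> where "\<kappa> < \<nu>" "\<delta> \<nu> \<le> u (y - \<iota> (z \<mu>))" by blast
  hence "\<forall>\<^sub>F \<rho> in at_top. \<delta> \<rho> < u (y - \<iota> (z \<mu>))" by (rule delta_eventually_le)
  hence "\<forall>\<^sub>F \<rho> in at_top. u (y - \<iota> (z \<rho>)) = \<delta> \<rho>"
    using eventually_gt_at_top[of \<mu>]
  proof eventually_elim
    case (elim \<rho>)
    thus ?case
      using U.add_eq_right[of "\<iota> (z \<mu>) - \<iota> (z \<rho>)" "y - \<iota> (z \<mu>)"]
      by (simp add: u_\<iota>_diff delta_eq minus_commute)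
  qed
  thus "pds_limit v z u \<iota> y" by (simp add: pds_limit_def)
qed

text \<open>The distance of a non-limit lies below every \<open>\<delta>\<close>, so passing from
  one member to another does not change it.\<close>

lemma not_pds_limit_value:
  assumes "\<not> pds_limit v z u \<iota> y"
  shows "u (y - \<iota> (z \<nu>)) = u (y - \<iota> (z \<mu>))"
proof -
  have less: "u (y - \<iota> (z \<kappa>)) < \<delta> \<rho>" if "\<sigma> < \<rho>" for \<kappa> \<rho> \<sigma>
    using assms that pds_limit_iff[of y \<kappa>] by (auto simp: not_le)
  have *: "u (y - \<iota> (z \<nu>)) = u (y - \<iota> (z \<mu>))" if "\<mu> < \<nu>" for \<mu> \<nu>
  proof -
    have "u (y - \<iota> (z \<mu>)) < u (\<iota> (z \<mu>) - \<iota> (z \<nu>))"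
      using less[OF that, of \<mu>] that by (simp add: u_\<iota>_diff delta_eq minus_commute)
    from U.add_eq_left[OF this] show ?thesis by simp
  qed
  show ?thesis using *[of \<mu> \<nu>] *[of \<nu> \<mu>] by (cases \<mu> \<nu> rule: linorder_cases) auto
qed

lemma pds_limit_\<iota>_z: "pds_limit v z u \<iota> (\<iota> (z \<mu>))"
proof -
  obtain \<nu> where "\<mu> < \<nu>" using gt_ex by blast
  thus ?thesis unfolding pds_limit_iff[of _ \<mu>] by auto
qed

end


section \<open>Linear factors and base change to the algebraic closure\<close>

lemma valuation_divide_nonneg_iff:
  fixes v :: "'f::field \<Rightarrow> 'g::linordered_ab_group_add extended"
  assumes "valuation v" "y \<noteq> 0"
  shows "0 \<le> v (x / y) \<longleftrightarrow> v y \<le> v x"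
proof -
  interpret domain_valuation v using assms by (simp add: valuation_iff_domain_valuation)
  obtain g where g: "v y = Fin g" using assms(2) by (rule FinE)
  have "v x = v (x / y) + Fin g" using assms(2) g mult[of "x / y" y] by simp
  thus ?thesis
    using g neq_Minf[of "x / y"] by (cases "v (x / y)") (auto simp: zero_extended_def)
qed

lemma ratfun_X_neq_const: "ratfun_X - ratfun_const a \<noteq> 0"
  by (simp add: ratfun_X_diff_const Zero_fract_def eq_fract)

lemma ratfun_to_ac_linear:
  "ratfun_to_ac (ratfun_X - ratfun_const a) = ratfun_X - ratfun_const (to_ac a)"
  by (simp add: ratfun_X_diff_const ratfun_to_ac_Fract map_poly_pCons)

lemma map_poly_to_ac_pcompose_linear:
  "map_poly to_ac (p \<circ>\<^sub>p [:a, 1:]) = map_poly to_ac p \<circ>\<^sub>p [:to_ac a, 1:]"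
proof (induction p)
  case (pCons c p)
  have add: "map_poly to_ac (r + s) = map_poly to_ac r + map_poly to_ac s" for r s :: "'a poly"
    by (rule poly_eqI) (simp add: coeff_map_poly)
  show ?case
    by (simp only: pcompose_pCons add map_poly_to_ac_mult pCons.IH map_poly_pCons
        to_ac_0 to_ac_1 map_poly_0)
qed simp

text \<open>\<open>w_linear\<close> and \<open>\<gamma>_less_delta\<close> record that
  \<open>X\<close> is not a limit: its distance to all members is the same \<open>\<gamma>\<close>,
  below every \<open>\<delta>\<close>.\<close>

locale pds_ratfun = pds_setup v z
  for v :: "'a::field \<Rightarrow> 'g::linordered_ab_group_add extended"
    and z :: "'i::{wellorder,no_top} \<Rightarrow> 'a" +
  fixes vbar :: "'a alg_closure \<Rightarrow> 'g extended"
    and w :: "'a poly fract \<Rightarrow> 'g extended"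
    and \<gamma> :: 'g
  assumes valuation_vbar: "valuation vbar" and extends_vbar: "extends_along to_ac v vbar"
    and valuation_w: "valuation w" and extends_w: "extends_along ratfun_const v w"
    and w_linear: "\<And>\<mu>. w (ratfun_X - ratfun_const (z \<mu>)) = Fin \<gamma>"
    and \<gamma>_less_delta: "\<And>\<kappa> \<nu> :: 'i. \<kappa> < \<nu> \<Longrightarrow> Fin \<gamma> < \<delta> \<nu>"
begin

sublocale A: pds_extension v z vbar to_ac
  using valuation_vbar extends_vbar by unfold_locales simp_all

sublocale W: domain_valuation w
  using valuation_w by (simp add: valuation_iff_domain_valuation)

lemma valuation_v: "valuation v"
  by (simp add: valuation_iff_domain_valuation domain_valuation_axioms)

lemma vbar_to_ac [simp]: "vbar (to_ac x) = v x"
  using extends_vbar by (simp add: extends_along_def)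

lemma w_const [simp]: "w (ratfun_const x) = v x"
  using extends_w by (simp add: extends_along_def)

text \<open>The second clause of condition (iii), with \<open>\<gamma>\<close> for the value of
  \<open>X - z \<mu>\<close>. The guard on \<open>\<nu>\<close> leaves out the least index.\<close>

definition is_cut :: bool where
  "is_cut \<longleftrightarrow> (\<forall>\<beta>\<in>value_group vbar. \<beta> < \<gamma> \<longleftrightarrow> (\<forall>\<nu>. (\<exists>\<kappa>. \<kappa> < \<nu>) \<longrightarrow> Fin \<beta> < \<delta> \<nu>))"

lemma is_cutI:
  assumes "\<And>\<beta>. \<beta> \<in> value_group vbar \<Longrightarrow> \<gamma> \<le> \<beta> \<Longrightarrow> \<exists>\<nu>. (\<exists>\<kappa>. \<kappa> < \<nu>) \<and> \<delta> \<nu> \<le> Fin \<beta>"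
  shows "is_cut"
  unfolding is_cut_def
proof (intro ballI iffI allI impI)
  fix \<beta> and \<nu> :: 'i assume "\<beta> < \<gamma>" "\<exists>\<kappa>. \<kappa> < \<nu>"
  thus "Fin \<beta> < \<delta> \<nu>" using \<gamma>_less_delta by (metis less_extended_simps(1) less_trans)
next
  fix \<beta> assume "\<beta> \<in> value_group vbar" "\<forall>\<nu>. (\<exists>\<kappa>. \<kappa> < \<nu>) \<longrightarrow> Fin \<beta> < \<delta> \<nu>"
  thus "\<beta> < \<gamma>" using assms[of \<beta>] by (meson not_le)
qed

text \<open>No \<open>\<beta>\<close> equals \<open>\<gamma>\<close>: unless
  \<open>\<beta> < \<gamma>\<close>, some \<open>\<delta> \<nu>\<close> is at most
  \<open>\<beta>\<close>, and \<open>\<gamma>\<close> is strictly below it.\<close>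

lemma is_cut_cases:
  assumes is_cut "\<beta> \<in> value_group vbar"
  obtains "\<beta> < \<gamma>" "\<forall>\<^sub>F \<nu> in at_top. Fin \<beta> < \<delta> \<nu>" | "\<gamma> < \<beta>" "\<forall>\<^sub>F \<nu> in at_top. \<delta> \<nu> < Fin \<beta>"
proof (cases "\<beta> < \<gamma>")
  case True
  with assms have "\<forall>\<nu>. (\<exists>\<kappa>. \<kappa> < \<nu>) \<longrightarrow> Fin \<beta> < \<delta> \<nu>"
    unfolding is_cut_def by simp
  hence "\<forall>\<^sub>F \<nu> in at_top. Fin \<beta> < \<delta> \<nu>"
    \<comment> \<open>Any index does for \<open>undefined\<close>; lying above it shows that
      \<open>\<nu>\<close> is not the least index.\<close>
    by (intro eventually_mono[OF eventually_gt_at_top[of undefined]]) blast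
  with True show thesis by (rule that(1))
next
  case False
  then obtain \<nu> \<kappa> where \<nu>: "\<kappa> < \<nu>" "\<delta> \<nu> \<le> Fin \<beta>"
    using assms unfolding is_cut_def by (meson not_le)
  have "Fin \<gamma> < Fin \<beta>" using \<gamma>_less_delta[OF \<nu>(1)] \<nu>(2) by (rule less_le_trans)
  thus thesis using delta_eventually_le[OF \<nu>] by (intro that(2)) auto
qed

text \<open>By divisibility such a multiple would be \<open>ntimes n \<beta>\<close>, and cancelling
  \<open>n\<close> would put \<open>\<gamma>\<close> itself into the group.\<close>

lemma is_cut_multiple_notin:
  assumes is_cut "n > 0"
  shows "ntimes n \<gamma> \<notin> value_group vbar"
proof
  assume "ntimes n \<gamma> \<in> value_group vbar"
  then obtain \<beta> where \<beta>: "\<beta> \<in> value_group vbar" "ntimes n \<gamma> = ntimes n \<beta>"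
    using valuation_vbar assms(2) value_group_divisible by metis
  hence "\<gamma> = \<beta>" using ntimes_less_iff[OF assms(2)] by (metis less_irrefl neqE)
  from is_cut_cases[OF assms(1) \<beta>(1)] show False
    by cases (simp_all add: \<open>\<gamma> = \<beta>\<close>[symmetric])
qed

section \<open>The cut from equality of valuation rings\<close>

text \<open>By torsion \<open>n \<beta>\<close> is the value of some \<open>c\<close> in the base
  field. For \<open>\<gamma> \<le> \<beta>\<close> the function \<open>c / (X - z \<mu>) ^ n\<close>
  lies in the ring of \<open>w\<close>; evaluating it along the sequence gives
  \<open>\<delta> \<nu> \<le> \<beta>\<close> eventually.\<close>

lemma is_cut_if_valuation_ring_eq:
  assumes "valuation_ring w = pds_valuation_ring v z"
  shows is_cut
proof (rule is_cutI)
  fix \<beta> assume \<beta>: "\<beta> \<in> value_group vbar" "\<gamma> \<le> \<beta>"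
  obtain n c where nc: "n > 0" "c \<noteq> 0" "v c = Fin (ntimes n \<beta>)"
    by (rule value_group_alg_closure_torsion[OF valuation_vbar extends_vbar \<beta>(1)])
  obtain \<mu> :: 'i where True by blast
  let ?q = "[:- z \<mu>, 1:] ^ n"
  let ?\<phi> = "Fract [:c:] ?q"
  have "w (Fract ?q 1) = Fin (ntimes n \<gamma>)"
    using w_linear[of \<mu>] by (simp add: ratfun_X_diff_const W.power ntimes_Fin flip: power_Fract)
  moreover have "w (Fract [:c:] 1) = Fin (ntimes n \<beta>)"
    using w_const[of c] nc(3) by (simp add: ratfun_const_def)
  moreover have "Fract ?q 1 \<noteq> 0" by (simp add: Zero_fract_def eq_fract)
  ultimately have "0 \<le> w (Fract [:c:] 1 / Fract ?q 1)"
    using \<beta>(2) valuation_divide_nonneg_iff[OF valuation_w] by (simp add: ntimes_mono del: divide_fract)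
  hence "0 \<le> w ?\<phi>" by simp
  hence "\<forall>\<^sub>F \<nu> in at_top. 0 \<le> v (ratfun_eval ?\<phi> (z \<nu>))"
    using assms by (auto simp: valuation_ring_def pds_valuation_ring_def)
  hence "\<forall>\<^sub>F \<nu> in at_top. \<mu> < \<nu> \<and> \<delta> \<nu> \<le> Fin \<beta>"
    using eventually_gt_at_top[of \<mu>] eventually_delta_Fin
  proof eventually_elim
    case (elim \<nu>)
    then obtain d where d: "v (z \<nu> - z \<mu>) = Fin d" by (auto simp: delta_eq)
    \<comment> \<open>A finite \<open>\<delta> \<nu>\<close> keeps \<open>z \<nu>\<close> away from
      the pole \<open>z \<mu>\<close>.\<close>
    hence ne: "z \<nu> - z \<mu> \<noteq> 0" by (metis extended.distinct(1) zero)
    hence "ratfun_eval ?\<phi> (z \<nu>) = c / (z \<nu> - z \<mu>) ^ n"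
      by (subst ratfun_eval_Fract) (simp_all add: poly_power)
    hence "Fin (ntimes n d) \<le> Fin (ntimes n \<beta>)"
      using elim(1) ne d nc
      by (simp add: valuation_divide_nonneg_iff[OF valuation_v] power ntimes_Fin)
    thus ?case using elim(2) d nc(1) by (simp add: delta_eq ntimes_le_iff)
  qed
  thus "\<exists>\<nu>. (\<exists>\<kappa>. \<kappa> < \<nu>) \<and> \<delta> \<nu> \<le> Fin \<beta>"
    using eventually_happens'[OF trivial_limit_at_top_linorder] by blast
qed

section \<open>The common extension given by the cut\<close>

text \<open>Two nonzero terms of equal value would put a positive multiple of
  \<open>\<gamma>\<close> into the value group of \<open>vbar\<close>; hence the values are distinct
  and \<open>w\<close> is their minimum.\<close>

lemma w_poly_eq_gauss:
  assumes is_cut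
  shows "w (Fract p 1) = gauss v \<gamma> (p \<circ>\<^sub>p [:z \<mu>, 1:])"
proof -
  let ?p = "p \<circ>\<^sub>p [:z \<mu>, 1:]"
  let ?f = "\<lambda>i. ratfun_const (Polynomial.coeff ?p i) * (ratfun_X - ratfun_const (z \<mu>)) ^ i"
  let ?I = "{..Polynomial.degree ?p}"
  have val: "w (?f i) = gterm \<gamma> ?p i" for i
    by (simp add: W.mult W.power w_linear ntimes_Fin)
  have *: False if ij: "i < j" "Polynomial.coeff ?p i \<noteq> 0" "Polynomial.coeff ?p j \<noteq> 0"
    "gterm \<gamma> ?p i = gterm \<gamma> ?p j" for i j
  proof -
    obtain g where g: "v (Polynomial.coeff ?p i) = Fin g" using FinE[OF ij(2)] .
    obtain h where h: "v (Polynomial.coeff ?p j) = Fin h" using FinE[OF ij(3)] .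
    have "g + ntimes i \<gamma> = h + (ntimes i \<gamma> + ntimes (j - i) \<gamma>)"
      using that(1,4) g h ntimes_add[of \<gamma> i "j - i"] by simp
    hence "ntimes (j - i) \<gamma> = g - h" by (simp add: algebra_simps)
    moreover have "g \<in> value_group vbar" "h \<in> value_group vbar"
      using g h by (auto intro: value_groupI[OF valuation_vbar, of "to_ac _"])
    ultimately show False
      using is_cut_multiple_notin[OF assms, of "j - i"] value_group_diff[OF valuation_vbar, of g h] that(1)
      by simp
  qed
  have "Fract p 1 = (\<Sum>i\<in>?I. ?f i)"
    unfolding Fract_pcompose_linear by (simp add: poly_as_sum_of_monoms pcompose_linear_inverse)
  also have "w \<dots> = Min ((\<lambda>i. w (?f i)) ` ?I)"
  proof (rule W.sum_distinct_values)
    fix i j assume ij: "i \<noteq> j" "?f i \<noteq> 0"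
    hence nz: "Polynomial.coeff ?p i \<noteq> 0"
      using W.eq_Pinf_iff[of "?f i"] unfolding val by simp
    show "w (?f i) \<noteq> w (?f j)"
    proof
      assume eq: "w (?f i) = w (?f j)"
      hence "Polynomial.coeff ?p j \<noteq> 0" using nz unfolding val by (metis gterm_eq_Pinf_iff)
      thus False using *[of i j] *[of j i] nz ij(1) eq unfolding val by (metis neqE)
    qed
  qed simp_all
  finally show ?thesis unfolding val gauss_def .
qed

text \<open>The Gauss valuation over \<open>vbar\<close> restricts to the one over \<open>v\<close>,
  which agrees with \<open>w\<close> on polynomials; fractions follow by cancelling the finite value
  of the denominator.\<close>

lemma common_extension_exists:
  assumes is_cut
  obtains wbar where "common_extension w vbar wbar"
    "is_monomial_valuation vbar (to_ac (z \<mu>)) (Fin \<gamma>) wbar"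
proof -
  obtain wbar where wbar: "is_monomial_valuation vbar (to_ac (z \<mu>)) (Fin \<gamma>) wbar"
    by (rule is_monomial_valuation_exists[OF valuation_vbar])
  hence val: "valuation wbar"
    and wbar_poly: "wbar (Fract p 1) = gauss vbar \<gamma> (p \<circ>\<^sub>p [:to_ac (z \<mu>), 1:])" for p
    by (simp_all add: is_monomial_valuation_iff[OF valuation_vbar])
  have gauss_eq: "gauss vbar \<gamma> (map_poly to_ac p) = gauss v \<gamma> p" for p
    by (simp add: gauss_def coeff_map_poly degree_map_poly)
  have poly_eq: "wbar (Fract (map_poly to_ac p) 1) = w (Fract p 1)" for p
    by (simp add: wbar_poly w_poly_eq_gauss[OF assms, of _ \<mu>] gauss_eq
        flip: map_poly_to_ac_pcompose_linear)
  have "wbar (ratfun_to_ac \<phi>) = w \<phi>" for \<phi>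
  proof -
    obtain p q where pq: "\<phi> = Fract p q" "q \<noteq> 0" by (cases \<phi>)
    let ?p = "map_poly to_ac p" and ?q = "map_poly to_ac q"
    have "?q \<noteq> 0" using pq(2) by (simp add: map_poly_eq_0_iff)
    hence "wbar (Fract ?p 1) = wbar (Fract ?p ?q) + wbar (Fract ?q 1)"
      using val by (intro domain_valuation_Fract) (simp add: valuation_iff_domain_valuation)
    moreover have "w (Fract p 1) = w (Fract p q) + w (Fract q 1)"
      using pq(2) by (intro domain_valuation_Fract W.domain_valuation_axioms)
    moreover obtain g where "w (Fract q 1) = Fin g"
      using W.FinE[of "Fract q 1"] pq(2) by (auto simp: Zero_fract_def eq_fract)
    moreover have "wbar (Fract ?p ?q) \<noteq> Minf" "w (Fract p q) \<noteq> Minf"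
      using val by (simp_all add: valuation_def)
    ultimately have "wbar (Fract ?p ?q) = w (Fract p q)"
      unfolding poly_eq by (cases "wbar (Fract ?p ?q)"; cases "w (Fract p q)") auto
    thus ?thesis using pq by (simp add: ratfun_to_ac_Fract)
  qed
  moreover have "wbar (ratfun_const c) = vbar c" for c
    by (simp add: ratfun_const_def wbar_poly)
  ultimately show thesis
    using val wbar by (intro that) (auto simp: common_extension_def extends_along_def)
qed

section \<open>Pairs of definition and limits\<close>

lemma wbar_linear_z:
  assumes "common_extension w vbar wbar"
  shows "wbar (ratfun_X - ratfun_const (to_ac (z \<mu>))) = Fin \<gamma>"
  using assms w_linear[of \<mu>]
  unfolding common_extension_def extends_along_def ratfun_to_ac_linear[symmetric] by metis

lemma pair_of_definition_Fin_iff: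
  assumes "wbar (ratfun_X - ratfun_const a) = Fin \<beta>"
  shows "pair_of_definition vbar wbar a (Fin \<beta>) \<longleftrightarrow> is_monomial_valuation vbar a (Fin \<beta>) wbar"
proof -
  have "\<beta> \<in> value_group wbar"
    using assms ratfun_X_neq_const unfolding value_group_def by blast
  thus ?thesis by (simp add: pair_of_definition_def)
qed

text \<open>The centre may be moved within the closed ball of radius \<open>\<gamma>\<close>, where
  \<open>X - a\<close> keeps the value \<open>\<gamma>\<close>.\<close>

lemma pair_of_definition_if_close:
  assumes "is_monomial_valuation vbar (to_ac (z \<mu>)) (Fin \<gamma>) wbar" "Fin \<gamma> \<le> vbar (a - to_ac (z \<mu>))"
  shows "pair_of_definition vbar wbar a (wbar (ratfun_X - ratfun_const a))"
proof -
  have eq: "wbar (ratfun_X - ratfun_const a) = Fin \<gamma>"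
    using is_monomial_valuation_linear[OF valuation_vbar assms(1), of a] assms(2)
    by (simp add: min_absorb2)
  show ?thesis
    unfolding eq pair_of_definition_Fin_iff[of wbar a \<gamma>, OF eq]
    by (rule is_monomial_valuation_shift[OF valuation_vbar assms])
qed

text \<open>A limit is within some \<open>\<delta> \<nu> > \<gamma>\<close> of
  \<open>z \<mu>\<close>, so it is a centre. A non-limit has distance \<open>\<beta>\<close> below
  every \<open>\<delta>\<close>, hence below \<open>\<gamma>\<close> by the cut; as a centre it
  would give \<open>X - z \<mu>\<close> the value \<open>\<beta>\<close> instead of
  \<open>\<gamma>\<close>.\<close>

lemma pair_of_definition_iff_pds_limit:
  assumes is_cut "common_extension w vbar wbar"
    and mono: "is_monomial_valuation vbar (to_ac (z \<mu>)) (Fin \<gamma>) wbar"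
  shows "pair_of_definition vbar wbar a (wbar (ratfun_X - ratfun_const a)) \<longleftrightarrow>
    pds_limit v z vbar to_ac a"
proof
  assume "pds_limit v z vbar to_ac a"
  then obtain \<nu> \<kappa> where "\<kappa> < \<nu>" "\<delta> \<nu> \<le> vbar (a - to_ac (z \<mu>))"
    unfolding A.pds_limit_iff[of a \<mu>] by blast
  with \<gamma>_less_delta have "Fin \<gamma> \<le> vbar (a - to_ac (z \<mu>))" by (meson less_imp_le order_trans)
  with mono show "pair_of_definition vbar wbar a (wbar (ratfun_X - ratfun_const a))"
    by (rule pair_of_definition_if_close)
next
  assume pair: "pair_of_definition vbar wbar a (wbar (ratfun_X - ratfun_const a))"
  show "pds_limit v z vbar to_ac a"
  proof (rule ccontr)
    assume not_limit: "\<not> pds_limit v z vbar to_ac a"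
    hence "a \<noteq> to_ac (z \<mu>)" using A.pds_limit_\<iota>_z by blast
    then obtain \<beta> where \<beta>: "vbar (a - to_ac (z \<mu>)) = Fin \<beta>"
      using A.U.FinE[of "a - to_ac (z \<mu>)"] by auto
    hence "\<beta> \<in> value_group vbar"
      by (rule value_groupI[OF valuation_vbar])
    moreover have "\<forall>\<nu>. (\<exists>\<kappa>. \<kappa> < \<nu>) \<longrightarrow> Fin \<beta> < \<delta> \<nu>"
      using not_limit \<beta> unfolding A.pds_limit_iff[of a \<mu>] by (auto simp: not_le)
    ultimately have "\<beta> < \<gamma>" using \<open>is_cut\<close> unfolding is_cut_def by blast
    hence eq: "wbar (ratfun_X - ratfun_const a) = Fin \<beta>"
      using is_monomial_valuation_linear[OF valuation_vbar mono, of a] \<beta> by simp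
    have "is_monomial_valuation vbar a (Fin \<beta>) wbar"
      using pair unfolding eq pair_of_definition_Fin_iff[of wbar a \<beta>, OF eq] .
    hence "wbar (ratfun_X - ratfun_const (to_ac (z \<mu>))) = Fin \<beta>"
      using is_monomial_valuation_linear[OF valuation_vbar, of a \<beta> wbar "to_ac (z \<mu>)"] \<beta>
      by (simp add: A.U.minus_commute)
    thus False using wbar_linear_z[OF assms(2), of \<mu>] \<open>\<beta> < \<gamma>\<close> by simp
  qed
qed

text \<open>Each \<open>z \<mu>\<close> is a limit and so a centre. Adding an element of value
  \<open>\<beta> \<ge> \<gamma>\<close> gives another centre, hence a limit, and this forces some
  \<open>\<delta> \<nu> \<le> \<beta>\<close>.\<close>

lemma is_cut_if_pairs_are_limits:
  assumes "common_extension w vbar wbar"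
    and pairs: "\<And>a. pair_of_definition vbar wbar a (wbar (ratfun_X - ratfun_const a)) \<longleftrightarrow>
      pds_limit v z vbar to_ac a"
  shows is_cut
proof (rule is_cutI)
  fix \<beta> assume \<beta>: "\<beta> \<in> value_group vbar" "\<gamma> \<le> \<beta>"
  obtain \<mu> :: 'i where True by blast
  have mono: "is_monomial_valuation vbar (to_ac (z \<mu>)) (Fin \<gamma>) wbar"
    using pairs[of "to_ac (z \<mu>)"] A.pds_limit_\<iota>_z[of \<mu>] wbar_linear_z[OF assms(1), of \<mu>]
    by (simp add: pair_of_definition_Fin_iff)
  obtain b where b: "vbar b = Fin \<beta>" using \<beta>(1) by (auto simp: value_group_def)
  let ?a = "to_ac (z \<mu>) + b"
  have "pds_limit v z vbar to_ac ?a"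
    using pair_of_definition_if_close[OF mono, of ?a] b \<beta>(2) pairs by simp
  thus "\<exists>\<nu>. (\<exists>\<kappa>. \<kappa> < \<nu>) \<and> \<delta> \<nu> \<le> Fin \<beta>"
    using b unfolding A.pds_limit_iff[of ?a \<mu>] by simp
qed

section \<open>Values along the sequence and the ring of \<open>v_E\<close>\<close>

text \<open>Roots are split off one at a time. A limit root adds \<open>\<gamma>\<close> to the
  \<open>wbar\<close>-value and eventually \<open>\<delta> \<nu>\<close> to the value at
  \<open>z \<nu>\<close>; any other root adds one constant \<open>\<beta>\<close> to both. So the
  same \<open>B\<close> and \<open>k\<close> serve both sides.\<close>

lemma polynomial_values:
  assumes is_cut "is_monomial_valuation vbar (to_ac (z \<mu>)) (Fin \<gamma>) wbar" "p \<noteq> 0"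
  shows "\<exists>B\<in>value_group vbar. \<exists>k. wbar (Fract p 1) = Fin (B + ntimes k \<gamma>) \<and>
    (\<forall>\<^sub>F \<nu> in at_top. vbar (poly p (to_ac (z \<nu>))) = Fin B + ntimes k (\<delta> \<nu>))"
  using assms(3)
proof (induction "Polynomial.degree p" arbitrary: p)
  case 0
  then obtain c where c: "p = [:c:]" "c \<noteq> 0" by (auto elim: degree_eq_zeroE)
  obtain B where B: "vbar c = Fin B" using c(2) by (rule A.U.FinE)
  have "wbar (Fract p 1) = Fin B"
    using assms(2) B c by (simp add: is_monomial_valuation_iff[OF valuation_vbar])
  moreover have "B \<in> value_group vbar" using valuation_vbar B by (rule value_groupI)
  ultimately show ?case
    using B c by (intro bexI[of _ B] exI[of _ 0]) auto
next
  case (Suc n)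
  obtain a where "poly p a = 0"
    using alg_closed_imp_poly_has_root[of p] Suc.hyps(2) by auto
  then obtain q where q: "p = [:- a, 1:] * q" by (auto simp: poly_eq_0_iff_dvd dvd_def)
  have "q \<noteq> 0" using Suc.prems q by auto
  moreover have "n = Polynomial.degree q"
    using Suc.hyps(2) \<open>q \<noteq> 0\<close> unfolding q by (subst (asm) degree_mult_eq) auto
  ultimately obtain B k where B: "B \<in> value_group vbar"
    and w_q: "wbar (Fract q 1) = Fin (B + ntimes k \<gamma>)"
    and v_q: "\<forall>\<^sub>F \<nu> in at_top. vbar (poly q (to_ac (z \<nu>))) = Fin B + ntimes k (\<delta> \<nu>)"
    using Suc.hyps(1) by blast
  have "Fract p 1 = Fract [:- a, 1:] 1 * Fract q 1" by (simp add: q)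
  hence "wbar (Fract p 1) = wbar (Fract [:- a, 1:] 1) + wbar (Fract q 1)"
    using assms(2) by (simp only: is_monomial_valuation_def valuation_def)
  hence w_p: "wbar (Fract p 1) = min (vbar (a - to_ac (z \<mu>))) (Fin \<gamma>) + Fin (B + ntimes k \<gamma>)"
    using is_monomial_valuation_linear[OF valuation_vbar assms(2), of a] w_q
    by (simp add: ratfun_X_diff_const)
  have v_p: "vbar (poly p x) = vbar (a - x) + vbar (poly q x)" for x
    unfolding q poly_mult A.U.mult by (simp add: A.U.minus_commute)
  show ?case
  proof (cases "pds_limit v z vbar to_ac a")
    case True
    then obtain \<nu> \<kappa> where "\<kappa> < \<nu>" "\<delta> \<nu> \<le> vbar (a - to_ac (z \<mu>))"
      unfolding A.pds_limit_iff[of a \<mu>] by blast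
    with \<gamma>_less_delta have "Fin \<gamma> \<le> vbar (a - to_ac (z \<mu>))" by (meson less_imp_le order_trans)
    hence "wbar (Fract p 1) = Fin (B + ntimes (Suc k) \<gamma>)"
      unfolding w_p by (simp add: min_absorb2 ac_simps)
    moreover have "\<forall>\<^sub>F \<nu> in at_top. vbar (poly p (to_ac (z \<nu>))) = Fin B + ntimes (Suc k) (\<delta> \<nu>)"
      using True v_q unfolding pds_limit_def by eventually_elim (simp add: v_p ac_simps)
    ultimately show ?thesis using B by blast
  next
    case False
    hence "a \<noteq> to_ac (z \<mu>)" using A.pds_limit_\<iota>_z by blast
    then obtain \<beta> where \<beta>: "vbar (a - to_ac (z \<mu>)) = Fin \<beta>"
      using A.U.FinE[of "a - to_ac (z \<mu>)"] by auto
    hence \<beta>_in: "\<beta> \<in> value_group vbar"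
      by (rule value_groupI[OF valuation_vbar])
    moreover have "\<forall>\<nu>. (\<exists>\<kappa>. \<kappa> < \<nu>) \<longrightarrow> Fin \<beta> < \<delta> \<nu>"
      using False \<beta> unfolding A.pds_limit_iff[of a \<mu>] by (auto simp: not_le)
    ultimately have "\<beta> < \<gamma>" using \<open>is_cut\<close> unfolding is_cut_def by blast
    hence "wbar (Fract p 1) = Fin (\<beta> + B + ntimes k \<gamma>)"
      unfolding w_p \<beta> by (simp add: ac_simps)
    moreover have "\<forall>\<^sub>F \<nu> in at_top. vbar (poly p (to_ac (z \<nu>))) = Fin (\<beta> + B) + ntimes k (\<delta> \<nu>)"
      using v_q
    proof eventually_elim
      case (elim \<nu>)
      have "vbar (a - to_ac (z \<nu>)) = Fin \<beta>"
        using A.not_pds_limit_value[OF False, of \<nu> \<mu>] \<beta> by simp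
      thus ?case by (simp only: v_p elim add.assoc flip: plus_extended.simps(1))
    qed
    ultimately show ?thesis using value_group_add[OF valuation_vbar \<beta>_in B] by blast
  qed
qed

text \<open>Dividing the difference of the constants by that of \<open>k\<close> and
  \<open>l\<close> reduces both sides to comparing one \<open>\<beta>\<close> with
  \<open>\<gamma>\<close> and with the tail of \<open>\<delta>\<close>; the cut makes the answers
  agree.\<close>

lemma eventually_affine_le_iff:
  assumes is_cut "B \<in> value_group vbar" "C \<in> value_group vbar"
  shows "B + ntimes k \<gamma> \<le> C + ntimes l \<gamma> \<longleftrightarrow>
    (\<forall>\<^sub>F \<nu> in at_top. Fin B + ntimes k (\<delta> \<nu>) \<le> Fin C + ntimes l (\<delta> \<nu>))"
    (is "_ \<longleftrightarrow> eventually ?P _")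
proof -
  have ev_iff: "(\<forall>\<^sub>F \<nu> in at_top. ?P \<nu>) \<longleftrightarrow> (\<forall>\<^sub>F \<nu> in at_top. Q \<nu>)"
    if "\<And>\<nu> d. \<delta> \<nu> = Fin d \<Longrightarrow> ?P \<nu> \<longleftrightarrow> Q \<nu>" for Q
    using that by (intro eventually_cong[OF eventually_delta_Fin]) auto
  \<comment> \<open>Eventual truth does not commute with negation; nontriviality of
    \<open>at_top\<close> refutes the false alternative.\<close>
  have not_both: "\<not> ((\<forall>\<^sub>F \<nu> in at_top. P \<nu>) \<and> (\<forall>\<^sub>F \<nu> in at_top. \<not> P \<nu>))" for P :: "'i \<Rightarrow> bool"
    using eventually_conj[of P at_top "\<lambda>\<nu>. \<not> P \<nu>"] by auto
  show ?thesis
  proof (cases k l rule: linorder_cases)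
    case equal
    have "?P \<nu> \<longleftrightarrow> B \<le> C" if "\<delta> \<nu> = Fin d" for \<nu> d
      using that equal by (simp add: ntimes_Fin)
    from ev_iff[OF this] show ?thesis using equal by simp
  next
    case less
    define n where "n = l - k"
    have n: "n > 0" "l = k + n" using less by (simp_all add: n_def)
    \<comment> \<open>The point at which the two affine functions cross.\<close>
    obtain \<beta> where \<beta>: "\<beta> \<in> value_group vbar" "B - C = ntimes n \<beta>"
      using value_group_divisible[OF valuation_vbar value_group_diff[OF valuation_vbar assms(2,3)] n(1)] .
    have iff: "B + ntimes k x \<le> C + ntimes l x \<longleftrightarrow> \<beta> \<le> x" for x
    proof -
      have "B + ntimes k x \<le> C + ntimes l x \<longleftrightarrow> B - C \<le> ntimes n x"
        by (simp add: n(2) ntimes_add algebra_simps)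
      thus ?thesis using \<beta>(2) n(1) by (simp add: ntimes_le_iff)
    qed
    hence "?P \<nu> \<longleftrightarrow> Fin \<beta> \<le> \<delta> \<nu>" if "\<delta> \<nu> = Fin d" for \<nu> d
      using that by (simp add: ntimes_Fin)
    from ev_iff[OF this] have *: "eventually ?P at_top \<longleftrightarrow> (\<forall>\<^sub>F \<nu> in at_top. Fin \<beta> \<le> \<delta> \<nu>)" .
    from is_cut_cases[OF assms(1) \<beta>(1)] show ?thesis
    proof cases
      case 1
      thus ?thesis unfolding iff * by (auto elim: eventually_mono)
    next
      case 2
      thus ?thesis
        unfolding iff * using not_both[of "\<lambda>\<nu>. Fin \<beta> \<le> \<delta> \<nu>"] by (auto simp: not_le)
    qed
  next
    case greater
    define n where "n = k - l"
    have n: "n > 0" "k = l + n" using greater by (simp_all add: n_def)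
    obtain \<beta> where \<beta>: "\<beta> \<in> value_group vbar" "C - B = ntimes n \<beta>"
      using value_group_divisible[OF valuation_vbar value_group_diff[OF valuation_vbar assms(3,2)] n(1)] .
    have iff: "B + ntimes k x \<le> C + ntimes l x \<longleftrightarrow> x \<le> \<beta>" for x
    proof -
      have "B + ntimes k x \<le> C + ntimes l x \<longleftrightarrow> ntimes n x \<le> C - B"
        by (simp add: n(2) ntimes_add algebra_simps)
      thus ?thesis using \<beta>(2) n(1) by (simp add: ntimes_le_iff)
    qed
    hence "?P \<nu> \<longleftrightarrow> \<delta> \<nu> \<le> Fin \<beta>" if "\<delta> \<nu> = Fin d" for \<nu> d
      using that by (simp add: ntimes_Fin)
    from ev_iff[OF this] have *: "eventually ?P at_top \<longleftrightarrow> (\<forall>\<^sub>F \<nu> in at_top. \<delta> \<nu> \<le> Fin \<beta>)" .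
    from is_cut_cases[OF assms(1) \<beta>(1)] show ?thesis
    proof cases
      case 1
      thus ?thesis
        unfolding iff * using not_both[of "\<lambda>\<nu>. \<delta> \<nu> \<le> Fin \<beta>"] by (auto simp: not_le)
    next
      case 2
      thus ?thesis unfolding iff * by (auto elim: eventually_mono)
    qed
  qed
qed

text \<open>Numerator and denominator have affine values with the same coefficients in
  \<open>\<gamma>\<close> and eventually in \<open>\<delta> \<nu>\<close>, so membership in either
  ring is the same comparison.\<close>

lemma valuation_ring_eq_if_is_cut:
  assumes is_cut
  shows "valuation_ring w = pds_valuation_ring v z"
proof -
  obtain \<mu> :: 'i where True by blast
  obtain wbar where wbar: "common_extension w vbar wbar"
      "is_monomial_valuation vbar (to_ac (z \<mu>)) (Fin \<gamma>) wbar"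
    using common_extension_exists[OF assms] .
  have poly_values: "\<exists>B\<in>value_group vbar. \<exists>k. w (Fract p 1) = Fin (B + ntimes k \<gamma>) \<and>
    (\<forall>\<^sub>F \<nu> in at_top. v (poly p (z \<nu>)) = Fin B + ntimes k (\<delta> \<nu>))" if "p \<noteq> 0" for p
  proof -
    have nz: "map_poly to_ac p \<noteq> 0" using that by (simp add: map_poly_eq_0_iff)
    have w_eq: "wbar (Fract (map_poly to_ac p) 1) = w (Fract p 1)"
      using wbar(1) ratfun_to_ac_Fract[of 1 p] unfolding common_extension_def extends_along_def
      by (metis map_poly_1' one_neq_zero to_ac_1)
    have eval_eq: "poly (map_poly to_ac p) (to_ac x) = to_ac (poly p x)" for x
      by (simp add: poly_altdef coeff_map_poly degree_map_poly to_ac_sum)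
    show ?thesis
      using polynomial_values[OF assms wbar(2) nz] unfolding w_eq eval_eq vbar_to_ac .
  qed
  have "0 \<le> w \<phi> \<longleftrightarrow> (\<forall>\<^sub>F \<nu> in at_top. 0 \<le> v (ratfun_eval \<phi> (z \<nu>)))" for \<phi>
  proof (cases "\<phi> = 0")
    case True
    have "ratfun_eval 0 x = 0" for x :: 'a
      unfolding Zero_fract_def by (simp add: ratfun_eval_Fract)
    thus ?thesis using True by simp
  next
    case False
    then obtain p q where pq: "\<phi> = Fract p q" "q \<noteq> 0" "p \<noteq> 0"
      by (cases \<phi> rule: Fract_cases_nonzero) auto
    obtain B k where B: "B \<in> value_group vbar" "w (Fract p 1) = Fin (B + ntimes k \<gamma>)"
        "\<forall>\<^sub>F \<nu> in at_top. v (poly p (z \<nu>)) = Fin B + ntimes k (\<delta> \<nu>)"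
      using poly_values[OF pq(3)] by blast
    obtain C l where C: "C \<in> value_group vbar" "w (Fract q 1) = Fin (C + ntimes l \<gamma>)"
        "\<forall>\<^sub>F \<nu> in at_top. v (poly q (z \<nu>)) = Fin C + ntimes l (\<delta> \<nu>)"
      using poly_values[OF pq(2)] by blast
    have "Fract q 1 \<noteq> 0" using pq(2) by (simp add: Zero_fract_def eq_fract)
    from valuation_divide_nonneg_iff[OF valuation_w this, of "Fract p 1"]
    have "0 \<le> w \<phi> \<longleftrightarrow> C + ntimes l \<gamma> \<le> B + ntimes k \<gamma>"
      by (simp add: pq(1) B C)
    also have "\<dots> \<longleftrightarrow> (\<forall>\<^sub>F \<nu> in at_top. Fin C + ntimes l (\<delta> \<nu>) \<le> Fin B + ntimes k (\<delta> \<nu>))"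
      by (rule eventually_affine_le_iff[OF assms C(1) B(1)])
    also have "\<dots> \<longleftrightarrow> (\<forall>\<^sub>F \<nu> in at_top. 0 \<le> v (ratfun_eval \<phi> (z \<nu>)))"
    proof (rule eventually_cong)
      show "\<forall>\<^sub>F \<nu> in at_top. (\<exists>d. \<delta> \<nu> = Fin d) \<and> v (poly p (z \<nu>)) = Fin B + ntimes k (\<delta> \<nu>) \<and>
          v (poly q (z \<nu>)) = Fin C + ntimes l (\<delta> \<nu>)"
        using eventually_delta_Fin B(3) C(3) by eventually_elim auto
    next
      fix \<nu>
      assume *: "(\<exists>d. \<delta> \<nu> = Fin d) \<and> v (poly p (z \<nu>)) = Fin B + ntimes k (\<delta> \<nu>) \<and>
          v (poly q (z \<nu>)) = Fin C + ntimes l (\<delta> \<nu>)"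
      \<comment> \<open>A finite value of the denominator excludes a pole at \<open>z \<nu>\<close>,
        so \<open>ratfun_eval\<close> is the actual quotient.\<close>
      hence "v (poly q (z \<nu>)) \<noteq> Pinf" by (auto simp: ntimes_Fin)
      hence "poly q (z \<nu>) \<noteq> 0" using eq_Pinf_iff by blast
      with * show "Fin C + ntimes l (\<delta> \<nu>) \<le> Fin B + ntimes k (\<delta> \<nu>) \<longleftrightarrow>
          0 \<le> v (ratfun_eval \<phi> (z \<nu>))"
        by (simp add: pq(1) ratfun_eval_Fract valuation_divide_nonneg_iff[OF valuation_v])
    qed
    finally show ?thesis .
  qed
  thus ?thesis by (auto simp: valuation_ring_def pds_valuation_ring_def)
qed

end

theorem theorem8p1:
  fixes v :: "'a::field \<Rightarrow> 'g::linordered_ab_group_add extended"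
    and vbar :: "'a alg_closure \<Rightarrow> 'g extended"
    and w :: "'a poly fract \<Rightarrow> 'g extended"
    and z :: "'i::{wellorder,no_top} \<Rightarrow> 'a"
  assumes "valuation v"
    and "valuation vbar" and "extends_along to_ac v vbar"
    and "valuation w" and "extends_along ratfun_const v w"
    and "value_transcendental v w"
    and "pseudo_divergent v z"
    and "\<not> pds_limit v z w ratfun_const ratfun_X"
  shows "let
      cond_i = (valuation_ring w = pds_valuation_ring v z);
      cond_ii =
        (\<exists>wbar. common_extension w vbar wbar \<and>
           (\<forall>a. pair_of_definition vbar wbar a (wbar (ratfun_X - ratfun_const a)) \<longleftrightarrow>
                pds_limit v z vbar to_ac a));
      cond_iii =
        (\<exists>\<mu>. (\<exists>wbar. common_extension w vbar wbar \<and>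
                 pair_of_definition vbar wbar (to_ac (z \<mu>)) (w (ratfun_X - ratfun_const (z \<mu>)))) \<and>
             (\<forall>\<beta> \<in> value_group vbar.
                Fin \<beta> < w (ratfun_X - ratfun_const (z \<mu>)) \<longleftrightarrow>
                (\<forall>\<nu>. (\<exists>\<kappa>. \<kappa> < \<nu>) \<longrightarrow> Fin \<beta> < pds_delta v z \<nu>)))
    in (cond_i \<longleftrightarrow> cond_ii) \<and> (cond_ii \<longleftrightarrow> cond_iii)"
proof -
  obtain \<mu>0 :: 'i where True by blast
  interpret pds_setup v z
    using assms(1,7) by (simp add: pds_setup_def pds_setup_axioms_def valuation_iff_domain_valuation)
  interpret W: pds_extension v z w ratfun_const
    using assms(4,5) by unfold_locales (simp_all add: ratfun_const_def)
  have less_delta: "w (ratfun_X - ratfun_const (z \<mu>0)) < \<delta> \<nu>" if "\<kappa> < \<nu>" for \<kappa> \<nu>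
    using assms(8) that unfolding W.pds_limit_iff[of _ \<mu>0] by (auto simp: not_le)
  obtain \<gamma> where \<gamma>: "w (ratfun_X - ratfun_const (z \<mu>0)) = Fin \<gamma>"
    using W.U.FinE[OF ratfun_X_neq_const] by blast
  interpret pds_ratfun v z vbar w \<gamma>
    using assms(2-5) less_delta W.not_pds_limit_value[OF assms(8), of _ \<mu>0]
    by unfold_locales (simp_all add: \<gamma>)
  define cond_ii where "cond_ii \<longleftrightarrow>
    (\<exists>wbar. common_extension w vbar wbar \<and>
           (\<forall>a. pair_of_definition vbar wbar a (wbar (ratfun_X - ratfun_const a)) \<longleftrightarrow>
                pds_limit v z vbar to_ac a))"
  define cond_iii where "cond_iii \<longleftrightarrow>
    (\<exists>\<mu>. (\<exists>wbar. common_extension w vbar wbar \<and>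
                 pair_of_definition vbar wbar (to_ac (z \<mu>)) (w (ratfun_X - ratfun_const (z \<mu>)))) \<and>
             (\<forall>\<beta> \<in> value_group vbar.
                Fin \<beta> < w (ratfun_X - ratfun_const (z \<mu>)) \<longleftrightarrow>
                (\<forall>\<nu>. (\<exists>\<kappa>. \<kappa> < \<nu>) \<longrightarrow> Fin \<beta> < pds_delta v z \<nu>)))"
  have i: "valuation_ring w = pds_valuation_ring v z \<longleftrightarrow> is_cut"
    using is_cut_if_valuation_ring_eq valuation_ring_eq_if_is_cut by blast
  \<comment> \<open>Both (ii) and (iii) ask for some \<open>wbar\<close>; the cut supplies the Gauss
    valuation.\<close>
  have exists: "\<exists>wbar. common_extension w vbar wbar \<and>
      is_monomial_valuation vbar (to_ac (z \<mu>0)) (Fin \<gamma>) wbar" if is_cut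
    using common_extension_exists[OF that] by blast
  have ii: "cond_ii \<longleftrightarrow> is_cut"
    unfolding cond_ii_def
    using exists is_cut_if_pairs_are_limits pair_of_definition_iff_pds_limit by blast
  have "pair_of_definition vbar wbar (to_ac (z \<mu>0)) (Fin \<gamma>)"
    if "common_extension w vbar wbar" "is_monomial_valuation vbar (to_ac (z \<mu>0)) (Fin \<gamma>) wbar" for wbar
    using that pair_of_definition_Fin_iff wbar_linear_z[OF that(1), of \<mu>0] by metis
  \<comment> \<open>For every \<open>\<mu>\<close> the value in (iii) is \<open>\<gamma>\<close>, so
    its second clause is \<open>is_cut\<close> itself; the pair is supplied at
    \<open>\<mu>0\<close>.\<close>
  hence iii: "cond_iii \<longleftrightarrow> is_cut"
    unfolding cond_iii_def w_linear less_extended_simps is_cut_def[symmetric] using exists by blast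
  show ?thesis
    unfolding Let_def cond_ii_def[symmetric] cond_iii_def[symmetric] using i ii iii by blast
qed

end
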